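(* Let $n\geq 1$, $M>n$ and $p>1$. There exists a sequence of centered probability measures $d\mu_k=f_k\,d\gamma$ on $\mathbb{R}^n$ belonging to $\mathcal{P}_2^M(\mathbb{R}^n)$ such that $\lim_{k\to\infty}\delta(\mu_k)=0$, $$\lim_{k\to\infty}W_2(\mu_k,\gamma)=c$$ for some constant $c>0$, and $$\liminf_{k\to\infty}\|f_k-1\|_{L^p(d\gamma)}>0.$$
   Context: $d\gamma=(2\pi)^{-n/2}e^{-|x|^2/2}\,dx$ is the standard Gaussian measure on $\mathbb{R}^n$. For a probability measure $d\mu=f\,d\gamma$ with $f\ge 0$ in $L^1(d\gamma)$, the Fisher information and relative entropy are $$\mathrm{I}(\mu)=\int_{\mathbb{R}^n}\frac{|\nabla f|^2}{f}\,d\gamma,\qquad \mathrm{H}(\mu)=\int_{\mathbb{R}^n}f\log f\,d\gamma,$$ and the deficit of the logarithmic Sobolev inequality is $\delta(\mu)=\frac12\mathrm{I}(\mu)-\mathrm{H}(\mu)\ge 0$. Centered means the barycenter $\int x\,d\mu$ is $0$. $\mathcal{P}_2^M(\mathbb{R}^n)$ is the set of probability measures $\mu$ on $\mathbb{R}^n$ with second moment $m_2(\mu)=\int|x|^2\,d\mu\le M$. The quadratic Wasserstein distance is $W_2(\mu,\nu)=\inf_\pi\left(\iint|x-y|^2\,d\pi(x,y)\right)^{1/2}$, the infimum being over all probability measures $\pi$ on $\mathbb{R}^n\times\mathbb{R}^n$ with marginals $\mu$ and $\nu$. *)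

theory Defs
  imports "HOL-Probability.Probability"
begin

definition std_gaussian :: "(real^'n) measure" where
  "std_gaussian =
     density lborel (\<lambda>x. ennreal ((2 * pi) powr (- real CARD('n) / 2) * exp (- (norm x)\<^sup>2 / 2)))"

text \<open>
  Real powers of extended nonnegative numbers, used only with a positive exponent, so that
  the value at infinity is infinity.
\<close>
definition ennreal_powr :: "ennreal \<Rightarrow> real \<Rightarrow> ennreal" where
  "ennreal_powr x a = (if x = \<top> then \<top> else ennreal (enn2real x powr a))"

text \<open>
  Distributional gradient. The identity is the vector form of
  \<open>\<integral> f \<partial>\<^sub>i\<phi> dx = - \<integral> g\<^sub>i \<phi> dx\<close>, tested against continuously differentiable functions
  \<open>\<phi>\<close> of compact support (equivalently, by mollification, against smooth ones).
\<close>
definition has_weak_gradient :: "(real^'n \<Rightarrow> real) \<Rightarrow> (real^'n \<Rightarrow> real^'n) \<Rightarrow> bool" where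
  "has_weak_gradient f g \<longleftrightarrow>
     (\<forall>K. compact K \<longrightarrow> set_integrable lborel K f \<and> set_integrable lborel K g) \<and>
     (\<forall>\<phi> \<phi>'. (\<forall>x. GDERIV \<phi> x :> \<phi>' x) \<and> continuous_on UNIV \<phi>' \<and>
         compact (closure {x. \<phi> x \<noteq> 0}) \<longrightarrow>
         (\<integral>x. f x *\<^sub>R \<phi>' x \<partial>lborel) = - (\<integral>x. \<phi> x *\<^sub>R g x \<partial>lborel))"

text \<open>A weak gradient is unique almost everywhere, so the choice does not affect integrals.\<close>
definition weak_gradient :: "(real^'n \<Rightarrow> real) \<Rightarrow> real^'n \<Rightarrow> real^'n" where
  "weak_gradient f = (SOME g. has_weak_gradient f g)"

text \<open>
  Fisher information, relative entropy and deficit of the measure with density \<open>f\<close> with respect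
  to the Gaussian. The Fisher information is infinite if \<open>f\<close> is not weakly differentiable. On
  \<open>{f = 0}\<close> the weak gradient of \<open>f\<close> vanishes almost everywhere and the integrand is
  \<open>0 / 0 = 0\<close>.
\<close>
definition fisher_information :: "(real^'n \<Rightarrow> real) \<Rightarrow> ennreal" where
  "fisher_information f =
     (if \<exists>g. has_weak_gradient f g
      then \<integral>\<^sup>+x. ennreal ((norm (weak_gradient f x))\<^sup>2 / f x) \<partial>std_gaussian
      else \<top>)"

text \<open>
  Since \<open>t ln t \<ge> - 1 / e\<close> and the Gaussian has mass one, for a nonnegative measurable \<open>f\<close> the
  integral can only fail to be finite by being \<open>+\<infinity>\<close>.
\<close>
definition relative_entropy :: "(real^'n \<Rightarrow> real) \<Rightarrow> ereal" where
  "relative_entropy f =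
     (if integrable std_gaussian (\<lambda>x. f x * ln (f x))
      then ereal (\<integral>x. f x * ln (f x) \<partial>std_gaussian)
      else \<infinity>)"

text \<open>
  Whenever the Fisher information is infinite, so is the deficit, also if the entropy is infinite
  (\<open>\<infinity> - \<infinity> = \<infinity>\<close> in \<^typ>\<open>ereal\<close>).
\<close>
definition deficit :: "(real^'n \<Rightarrow> real) \<Rightarrow> ereal" where
  "deficit f = enn2ereal (fisher_information f) / 2 - relative_entropy f"

definition centered :: "(real^'n) measure \<Rightarrow> bool" where
  "centered \<mu> \<longleftrightarrow> integrable \<mu> (\<lambda>x. x) \<and> (\<integral>x. x \<partial>\<mu>) = 0"

definition second_moment :: "(real^'n) measure \<Rightarrow> ennreal" where
  "second_moment \<mu> = (\<integral>\<^sup>+x. ennreal ((norm x)\<^sup>2) \<partial>\<mu>)"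

definition P2 :: "real \<Rightarrow> (real^'n) measure set" where
  "P2 M = {\<mu>. sets \<mu> = sets borel \<and> prob_space \<mu> \<and> second_moment \<mu> \<le> ennreal M}"

definition couplings ::
  "(real^'n) measure \<Rightarrow> (real^'n) measure \<Rightarrow> ((real^'n) \<times> (real^'n)) measure set" where
  "couplings \<mu> \<nu> =
     {\<pi>. prob_space \<pi> \<and> sets \<pi> = sets (borel \<Otimes>\<^sub>M borel) \<and>
         distr \<pi> borel fst = \<mu> \<and> distr \<pi> borel snd = \<nu>}"

definition W2 :: "(real^'n) measure \<Rightarrow> (real^'n) measure \<Rightarrow> ennreal" where
  "W2 \<mu> \<nu> =
     (INF \<pi>\<in>couplings \<mu> \<nu>. ennreal_powr (\<integral>\<^sup>+z. ennreal ((norm (fst z - snd z))\<^sup>2) \<partial>\<pi>) (1 / 2))"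

definition Lp_norm :: "real \<Rightarrow> 'a measure \<Rightarrow> ('a \<Rightarrow> real) \<Rightarrow> ennreal" where
  "Lp_norm p M f = ennreal_powr (\<integral>\<^sup>+x. ennreal (\<bar>f x\<bar> powr p) \<partial>M) (1 / p)"

end

theory Submission
  imports Defs "HOL-Real_Asymp.Real_Asymp"
begin

text \<open>
  The examples are mixtures of \<open>\<gamma>\<close> with weight \<open>1 - 2 t\<close> and its translates by \<open>v\<close> and \<open>- v\<close> with
  weight \<open>t\<close> each, where \<open>t \<rightarrow> 0\<close> and \<open>2 t |v|\<^sup>2 = M - n\<close> is kept fixed. Since the bumps separate, the
  Fisher information tends to \<open>2 t |v|\<^sup>2\<close> and the entropy to half of it, so the deficit vanishes in the
  limit although the second moment stays at \<open>M > n\<close>; the latter bounds \<open>W\<^sub>2(\<mu>\<^sub>k, \<gamma>)\<close> away from zero.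
  As \<open>W\<^sub>2(\<mu>\<^sub>k, \<gamma>)\<close> is also bounded above, it converges along a subsequence. The \<open>L\<^sup>p\<close> norms even
  diverge, since \<open>p > 1\<close> makes the factor \<open>exp (p (p - 1) |v|\<^sup>2 / 2)\<close> beat \<open>t\<^sup>p\<close>.
\<close>

section \<open>Weak gradients\<close>

text \<open>Each bump alone is an equality case of the logarithmic Sobolev inequality: the translate
  of \<gamma> by v has Fisher information |v|^2 and entropy |v|^2 / 2. The deficit of a mixture
  therefore records only how far information and entropy fail to add up over the components. For the
  entropy this failure is at most the Shannon entropy of the weights 1 - 2 t, t, t; for the
  information it is controlled by overlaps of the components, which are exponentially small in
  |v|^2. The limit 0 is obtained by squeezing, so both quantities are bounded from both sides. Using
  v and - v with equal weight keeps the barycenter at 0. The obstacle that shapes the development is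
  that \<open>weak_gradient\<close> is an arbitrary choice. The classical gradient may replace it
  only once it is known to be a weak gradient and any two weak gradients are known to agree almost
  everywhere; the bumps on boxes serve this uniqueness.\<close>

lemma GDERIV_unique:
  assumes "GDERIV f x :> a" "GDERIV f x :> b"
  shows "a = b"
proof -
  have "(\<lambda>h. h \<bullet> a) = (\<lambda>h. h \<bullet> b)"
    using assms has_derivative_unique unfolding gderiv_def by blast
  then have "(a - b) \<bullet> a = (a - b) \<bullet> b"
    by meson
  then have "(a - b) \<bullet> (a - b) = 0"
    by (simp add: inner_diff_right)
  then show ?thesis
    by simp
qed

lemma GDERIV_continuous_on:
  assumes "\<And>x. GDERIV f x :> f' x"
  shows "continuous_on S f"
proof (intro continuous_at_imp_continuous_on ballI)
  fix x
  have "(f has_derivative (\<lambda>h. h \<bullet> f' x)) (at x)"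
    using assms by (simp add: gderiv_def)
  then show "isCont f x"
    by (rule has_derivative_continuous)
qed

lemma GDERIV_zero_outside_support:
  assumes "\<And>x. GDERIV f x :> f' x" "closed K" "\<And>x. x \<notin> K \<Longrightarrow> f x = 0" "x \<notin> K"
  shows "f' x = 0"
proof (rule GDERIV_unique)
  show "GDERIV f x :> f' x"
    by fact
  have "((\<lambda>x. 0) has_derivative (\<lambda>h. 0)) (at x)"
    by simp
  then have "(f has_derivative (\<lambda>h. 0)) (at x)"
    by (rule has_derivative_transform_within_open[of _ _ _ UNIV "- K"])
      (use assms in \<open>auto simp: open_Compl\<close>)
  then show "GDERIV f x :> 0"
    by (simp add: gderiv_def)
qed

lemma GDERIV_line:
  assumes "\<And>x. GDERIV f x :> f' x"
  shows "((\<lambda>r. f (x + r *\<^sub>R v)) has_real_derivative (f' (x + r *\<^sub>R v) \<bullet> v)) (at r)"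
proof -
  have "((\<lambda>r. x + r *\<^sub>R v) has_derivative (\<lambda>s. s *\<^sub>R v)) (at r)"
    by (auto intro!: derivative_eq_intros)
  moreover have "(f has_derivative (\<lambda>h. h \<bullet> f' (x + r *\<^sub>R v))) (at (x + r *\<^sub>R v))"
    using assms by (simp add: gderiv_def)
  ultimately have "((\<lambda>r. f (x + r *\<^sub>R v)) has_derivative (\<lambda>s. (s *\<^sub>R v) \<bullet> f' (x + r *\<^sub>R v))) (at r)"
    by (rule has_derivative_compose)
  moreover have "(\<lambda>s. (s *\<^sub>R v) \<bullet> f' (x + r *\<^sub>R v)) = (*) (f' (x + r *\<^sub>R v) \<bullet> v)"
    by (auto simp: inner_commute)
  ultimately show ?thesis
    by (simp add: has_field_derivative_def)
qed

lemma integrable_continuous_compact_support: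
  fixes f :: "'a::euclidean_space \<Rightarrow> 'b::{banach, second_countable_topology}"
  assumes "continuous_on UNIV f" "compact K" "\<And>x. x \<notin> K \<Longrightarrow> f x = 0"
  shows "integrable lborel f"
proof -
  have "integrable lborel (\<lambda>x. indicator K x *\<^sub>R f x)"
    by (intro borel_integrable_compact assms continuous_on_subset[OF assms(1)]) auto
  moreover have "(\<lambda>x. indicator K x *\<^sub>R f x) = f"
    using assms(3) by (fastforce simp: indicator_def)
  ultimately show ?thesis
    by simp
qed

text \<open>Each component of the gradient is the limit of difference quotients, whose integrals vanish
  by translation invariance.\<close>

lemma integral_gradient_eq_0:
  fixes h :: "'a::euclidean_space \<Rightarrow> real"
  assumes h: "\<And>x. GDERIV h x :> h' x" and cont: "continuous_on UNIV h'"
    and K: "compact K" "\<And>x. x \<notin> K \<Longrightarrow> h x = 0"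
  shows "(\<integral>x. h' x \<partial>lborel) = 0"
proof (rule euclidean_eqI)
  fix i :: 'a assume i: "i \<in> Basis"
  have h'0: "h' x = 0" if "x \<notin> K" for x
    using GDERIV_zero_outside_support[OF h compact_imp_closed[OF K(1)] K(2) that] by blast
  have int': "integrable lborel h'"
    by (rule integrable_continuous_compact_support[OF cont K(1) h'0])
  have conth: "continuous_on UNIV h"
    using GDERIV_continuous_on[OF h] .
  have inth: "integrable lborel h"
    by (rule integrable_continuous_compact_support[OF conth K])
  obtain R where R: "\<And>x. x \<in> K \<Longrightarrow> norm x \<le> R"
    using compact_imp_bounded[OF K(1)] unfolding bounded_iff by blast
  have "bounded (h' ` K)"
    by (intro compact_imp_bounded compact_continuous_image continuous_on_subset[OF cont] K) auto
  then obtain B0 where B0: "\<And>x. x \<in> K \<Longrightarrow> norm (h' x) \<le> B0"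
    unfolding bounded_iff by blast
  define B where "B = max B0 0"
  have B: "norm (h' x) \<le> B" for x
    using B0 h'0 unfolding B_def by (cases "x \<in> K") (auto simp: le_max_iff_disj)
  define q where "q m x = (h (x + (1 / real (Suc m)) *\<^sub>R i) - h x) * real (Suc m)" for m x
  \<comment> \<open>The mean value theorem bounds the quotient by the supremum of the gradient. The
    radius is R + 1 because the shift has length at most 1: beyond that radius both evaluation
    points lie outside \<open>K\<close>.\<close>
  have qbound: "norm (q m x) \<le> B * indicator (cball 0 (R + 1)) x" for m x
  proof (cases "x \<in> cball 0 (R + 1)")
    case True
    have "\<exists>z. 0 < z \<and> z < 1 / real (Suc m) \<and>
        h (x + (1 / real (Suc m)) *\<^sub>R i) - h (x + 0 *\<^sub>R i)
          = (1 / real (Suc m) - 0) * (h' (x + z *\<^sub>R i) \<bullet> i)"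
      by (rule MVT2) (auto intro!: GDERIV_line h)
    then obtain z where z: "h (x + (1 / real (Suc m)) *\<^sub>R i) - h x
        = (1 / real (Suc m)) * (h' (x + z *\<^sub>R i) \<bullet> i)"
      by auto
    have "q m x = h' (x + z *\<^sub>R i) \<bullet> i"
      unfolding q_def z by simp
    also have "norm \<dots> \<le> B"
      using B[of "x + z *\<^sub>R i"] norm_nth_le[OF i, of "h' (x + z *\<^sub>R i)"] by simp
    finally show ?thesis
      using True by simp
  next
    case False
    then have x: "norm x > R + 1"
      by simp
    have "norm ((1 / real (Suc m)) *\<^sub>R i) = 1 / real (Suc m)"
      using i by simp
    also have "\<dots> \<le> 1"
      by simp
    finally have "norm (x + (1 / real (Suc m)) *\<^sub>R i) > R"
      using x norm_triangle_ineq4[of "x + (1 / real (Suc m)) *\<^sub>R i" "(1 / real (Suc m)) *\<^sub>R i"]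
      unfolding add_diff_cancel_right' by linarith
    then have "h (x + (1 / real (Suc m)) *\<^sub>R i) = 0" "h x = 0"
      using R K(2) x by force+
    then show ?thesis
      using False by (simp add: q_def)
  qed
  have q0: "(\<integral>x. q m x \<partial>lborel) = 0" for m
  proof -
    let ?v = "(1 / real (Suc m)) *\<^sub>R i"
    have [measurable]: "h \<in> borel_measurable borel"
      using conth by (rule borel_measurable_continuous_onI)
    have eq: "(\<integral>x. h x \<partial>lborel) = (\<integral>x. h (x + ?v) \<partial>lborel)"
      by (subst lborel_distr_plus[symmetric, of ?v]) (simp add: integral_distr add.commute)
    have "integrable (distr lborel borel ((+) ?v)) h"
      using inth by (simp add: lborel_distr_plus)
    then have "integrable lborel (\<lambda>x. h (x + ?v))"
      by (subst (asm) integrable_distr_eq) (auto simp: add.commute)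
    then show ?thesis
      unfolding q_def using inth eq by simp
  qed
  have lim: "(\<lambda>m. q m x) \<longlonglongrightarrow> h' x \<bullet> i" for x
  proof -
    have "((\<lambda>r. h (x + r *\<^sub>R i)) has_real_derivative (h' (x + 0 *\<^sub>R i) \<bullet> i)) (at 0)"
      by (rule GDERIV_line[OF h])
    then have "((\<lambda>r. (h (x + r *\<^sub>R i) - h x) / r) \<longlongrightarrow> h' x \<bullet> i) (at 0)"
      by (simp add: DERIV_def)
    moreover have "filterlim (\<lambda>m. 1 / real (Suc m)) (at 0) sequentially"
      unfolding filterlim_at using LIMSEQ_inverse_real_of_nat by (simp add: divide_inverse)
    ultimately have "(\<lambda>m. (h (x + (1 / real (Suc m)) *\<^sub>R i) - h x) / (1 / real (Suc m)))
        \<longlonglongrightarrow> h' x \<bullet> i"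
      by (rule filterlim_compose)
    then show ?thesis
      unfolding q_def by simp
  qed
  have "(\<lambda>m. \<integral>x. q m x \<partial>lborel) \<longlonglongrightarrow> (\<integral>x. h' x \<bullet> i \<partial>lborel)"
  proof (rule integral_dominated_convergence)
    have [measurable]: "h \<in> borel_measurable borel"
      using conth by (rule borel_measurable_continuous_onI)
    show "q m \<in> borel_measurable lborel" for m
      unfolding q_def by measurable
    show "(\<lambda>x. h' x \<bullet> i) \<in> borel_measurable lborel"
      using int' by measurable
    show "integrable lborel (\<lambda>x. B * indicator (cball 0 (R + 1)) x)"
      by (intro integrable_mult_right integrable_real_indicator emeasure_bounded_finite) auto
  qed (use lim qbound in auto)
  then have "(\<integral>x. h' x \<bullet> i \<partial>lborel) = 0"
    unfolding q0 using LIMSEQ_unique tendsto_const by blast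
  then show "(\<integral>x. h' x \<partial>lborel) \<bullet> i = 0 \<bullet> i"
    using int' by simp
qed

text \<open>Product rule: the product of \<open>f\<close> with a test function is again C^1 with
  compact support, so the integral of its gradient vanishes, and the two summands of that gradient
  are integrable separately.\<close>

lemma has_weak_gradient_C1:
  fixes f :: "real^'n \<Rightarrow> real"
  assumes f: "\<And>x. GDERIV f x :> f' x" and cont': "continuous_on UNIV f'"
  shows "has_weak_gradient f f'"
  unfolding has_weak_gradient_def
proof (intro conjI allI impI)
  have cont: "continuous_on UNIV f"
    using GDERIV_continuous_on[OF f] .
  show "set_integrable lborel K f" if "compact K" for K
    unfolding set_integrable_def
    by (intro borel_integrable_compact that continuous_on_subset[OF cont]) auto
  show "set_integrable lborel K f'" if "compact K" for K
    unfolding set_integrable_def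
    by (intro borel_integrable_compact that continuous_on_subset[OF cont']) auto
  fix \<phi> :: "real^'n \<Rightarrow> real" and \<phi>'
  assume *: "(\<forall>x. GDERIV \<phi> x :> \<phi>' x) \<and> continuous_on UNIV \<phi>' \<and> compact (closure {x. \<phi> x \<noteq> 0})"
  let ?K = "closure {x. \<phi> x \<noteq> 0}"
  from * have \<phi>: "\<And>x. GDERIV \<phi> x :> \<phi>' x" and cont\<phi>': "continuous_on UNIV \<phi>'" and cK: "compact ?K"
    by auto
  have K: "\<phi> x = 0" if "x \<notin> ?K" for x
    using that closure_subset[of "{x. \<phi> x \<noteq> 0}"] by blast
  have K': "\<phi>' x = 0" if "x \<notin> ?K" for x
    using GDERIV_zero_outside_support[OF \<phi> closed_closure K that] .
  have cont\<phi>: "continuous_on UNIV \<phi>"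
    using GDERIV_continuous_on[OF \<phi>] .
  have i1: "integrable lborel (\<lambda>x. f x *\<^sub>R \<phi>' x)"
    by (rule integrable_continuous_compact_support[OF continuous_on_scaleR[OF cont cont\<phi>'] cK])
      (drule K', simp only: scaleR_zero_right)
  have i2: "integrable lborel (\<lambda>x. \<phi> x *\<^sub>R f' x)"
    by (rule integrable_continuous_compact_support[OF continuous_on_scaleR[OF cont\<phi> cont'] cK])
      (drule K, simp only: scaleR_zero_left)
  have "(\<integral>x. f x *\<^sub>R \<phi>' x + \<phi> x *\<^sub>R f' x \<partial>lborel) = 0"
  proof (rule integral_gradient_eq_0[OF GDERIV_mult[OF f \<phi>] _ cK])
    show "continuous_on UNIV (\<lambda>x. f x *\<^sub>R \<phi>' x + \<phi> x *\<^sub>R f' x)"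
      by (intro continuous_intros cont cont' cont\<phi> cont\<phi>')
  qed (drule K, simp only: mult_zero_right)
  then show "(\<integral>x. f x *\<^sub>R \<phi>' x \<partial>lborel) = - (\<integral>x. \<phi> x *\<^sub>R f' x \<partial>lborel)"
    using i1 i2 by (simp add: add_eq_0_iff)
qed

lemma has_weak_gradient_set_integrable:
  assumes "has_weak_gradient f g" "compact K"
  shows "set_integrable lborel K g"
  using assms by (simp add: has_weak_gradient_def)

lemma has_weak_gradientD:
  assumes "has_weak_gradient f g" and "\<And>x. GDERIV \<phi> x :> \<phi>' x" "continuous_on UNIV \<phi>'"
    and "compact (closure {x. \<phi> x \<noteq> 0})"
  shows "(\<integral>x. f x *\<^sub>R \<phi>' x \<partial>lborel) = - (\<integral>x. \<phi> x *\<^sub>R g x \<partial>lborel)"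
  using assms(1)[unfolded has_weak_gradient_def, THEN conjunct2, THEN spec[of _ \<phi>], THEN spec[of _ \<phi>']]
    assms(2-4) by (simp only: simp_thms)

section \<open>Almost everywhere uniqueness of weak gradients\<close>

lemma DERIV_max0_square:
  "((\<lambda>y::real. (max 0 y)\<^sup>2) has_real_derivative 2 * max 0 y) (at y)"
proof (cases "y = 0")
  case True
  have "((\<lambda>h::real. (max 0 h)\<^sup>2 / h) \<longlongrightarrow> 0) (at 0)"
  proof (rule Lim_null_comparison)
    show "\<forall>\<^sub>F h in at 0. norm ((max 0 h)\<^sup>2 / h) \<le> \<bar>h::real\<bar>"
      by (rule always_eventually) (auto simp: max_def power2_eq_square)
    show "((\<lambda>h::real. \<bar>h\<bar>) \<longlongrightarrow> 0) (at 0)"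
      by (intro tendsto_rabs_zero tendsto_ident_at)
  qed
  then show ?thesis
    using True by (simp add: DERIV_def)
next
  case False
  then consider "y < 0" | "y > 0"
    by linarith
  then show ?thesis
  proof cases
    case 1
    have "((\<lambda>y::real. 0) has_real_derivative 2 * max 0 y) (at y)"
      using 1 by simp
    then show ?thesis
      by (rule DERIV_cong_ev[THEN iffD1, OF refl _ refl, rotated])
        (use eventually_nhds_in_open[of "{..<0}" y] 1 in \<open>auto elim!: eventually_mono\<close>)
  next
    case 2
    have "((\<lambda>y::real. y\<^sup>2) has_real_derivative 2 * max 0 y) (at y)"
      using 2 by (auto intro!: derivative_eq_intros)
    then show ?thesis
      by (rule DERIV_cong_ev[THEN iffD1, OF refl _ refl, rotated])
        (use eventually_nhds_in_open[of "{0<..}" y] 2 in \<open>auto elim!: eventually_mono\<close>)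
  qed
qed

text \<open>The squares smooth the kinks of the positive parts, so the function is C^1, the
  regularity asked of test functions in \<open>has_weak_gradient\<close>; its positivity set is the
  open box with no slack.\<close>

definition box_bump :: "'a::euclidean_space \<Rightarrow> 'a \<Rightarrow> 'a \<Rightarrow> real" where
  "box_bump a b x = (\<Prod>i\<in>Basis. (max 0 (x \<bullet> i - a \<bullet> i))\<^sup>2 * (max 0 (b \<bullet> i - x \<bullet> i))\<^sup>2)"

lemma box_bump_nonneg: "box_bump a b x \<ge> 0"
  by (simp add: box_bump_def prod_nonneg)

lemma box_bump_pos_iff: "box_bump a b x > 0 \<longleftrightarrow> x \<in> box a b"
proof
  assume "x \<in> box a b"
  then show "box_bump a b x > 0"
    unfolding box_bump_def by (intro prod_pos) (auto simp: mem_box)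
next
  assume "box_bump a b x > 0"
  have ne: "(max 0 (x \<bullet> i - a \<bullet> i))\<^sup>2 * (max 0 (b \<bullet> i - x \<bullet> i))\<^sup>2 \<noteq> 0" if "i \<in> Basis" for i
  proof
    assume "(max 0 (x \<bullet> i - a \<bullet> i))\<^sup>2 * (max 0 (b \<bullet> i - x \<bullet> i))\<^sup>2 = 0"
    then have "box_bump a b x = 0"
      unfolding box_bump_def using that by (intro prod_zero finite_Basis) blast
    then show False
      using \<open>box_bump a b x > 0\<close> by simp
  qed
  show "x \<in> box a b"
    unfolding mem_box
  proof (intro ballI conjI)
    fix i :: 'a assume i: "i \<in> Basis"
    show "a \<bullet> i < x \<bullet> i" "x \<bullet> i < b \<bullet> i"
      using ne[OF i] by (simp_all add: max_def split: if_splits)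
  qed
qed

lemma box_bump_GDERIV:
  obtains D where "\<And>x. GDERIV (box_bump a b) x :> D x" "continuous_on UNIV D"
proof
  let ?f = "\<lambda>i x. (max 0 (x \<bullet> i - a \<bullet> i))\<^sup>2 * (max 0 (b \<bullet> i - x \<bullet> i))\<^sup>2"
  let ?c = "\<lambda>i x. 2 * max 0 (x \<bullet> i - a \<bullet> i) * (max 0 (b \<bullet> i - x \<bullet> i))\<^sup>2
      - (max 0 (x \<bullet> i - a \<bullet> i))\<^sup>2 * (2 * max 0 (b \<bullet> i - x \<bullet> i))"
  let ?D = "\<lambda>x. \<Sum>i\<in>Basis. (?c i x * (\<Prod>j\<in>Basis - {i}. ?f j x)) *\<^sub>R i"
  show "GDERIV (box_bump a b) x :> ?D x" for x
  proof -
    have "(?f i has_derivative (\<lambda>h. (h \<bullet> i) * ?c i x)) (at x)" for i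
    proof -
      have 1: "((\<lambda>x. (max 0 (x \<bullet> i - a \<bullet> i))\<^sup>2) has_derivative (\<lambda>h. (h \<bullet> i) * (2 * max 0 (x \<bullet> i - a \<bullet> i)))) (at x)"
      proof -
        have "((\<lambda>x. x \<bullet> i - a \<bullet> i) has_derivative (\<lambda>h. h \<bullet> i)) (at x)"
          by (auto intro!: derivative_eq_intros)
        from has_derivative_compose[OF this DERIV_max0_square[unfolded has_field_derivative_def]]
        show ?thesis
          by (simp add: mult.commute)
      qed
      have 2: "((\<lambda>x. (max 0 (b \<bullet> i - x \<bullet> i))\<^sup>2) has_derivative (\<lambda>h. - (h \<bullet> i) * (2 * max 0 (b \<bullet> i - x \<bullet> i)))) (at x)"
      proof -
        have "((\<lambda>x. b \<bullet> i - x \<bullet> i) has_derivative (\<lambda>h. - (h \<bullet> i))) (at x)"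
          by (auto intro!: derivative_eq_intros)
        from has_derivative_compose[OF this DERIV_max0_square[unfolded has_field_derivative_def]]
        show ?thesis
          by (simp add: mult.commute)
      qed
      show ?thesis
        using has_derivative_mult[OF 1 2] by (simp add: algebra_simps)
    qed
    then have "(box_bump a b has_derivative (\<lambda>h. \<Sum>i\<in>Basis. ((h \<bullet> i) * ?c i x) * (\<Prod>j\<in>Basis - {i}. ?f j x))) (at x)"
      unfolding box_bump_def[abs_def] by (rule has_derivative_prod)
    moreover have "(\<Sum>i\<in>Basis. ((h \<bullet> i) * ?c i x) * (\<Prod>j\<in>Basis - {i}. ?f j x)) = h \<bullet> ?D x" for h
      unfolding inner_sum_right inner_scaleR_right by (intro sum.cong) (simp_all only: mult_ac)
    ultimately show ?thesis
      unfolding gderiv_def by simp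
  qed
  show "continuous_on UNIV ?D"
    by (intro continuous_intros)
qed

text \<open>The map y -> m y / (1 + m y) fixes 0 and tends to 1 at every y > 0, so it turns a
  nonnegative function into the indicator of its positivity set while staying below 1.\<close>

lemma indicator_box_LIMSEQ:
  "(\<lambda>m. real m * box_bump a b x / (1 + real m * box_bump a b x)) \<longlonglongrightarrow> indicator (box a b) x"
proof (cases "x \<in> box a b")
  case True
  then have "box_bump a b x > 0"
    by (simp add: box_bump_pos_iff)
  then have "(\<lambda>m. real m * box_bump a b x / (1 + real m * box_bump a b x)) \<longlonglongrightarrow> 1"
    by real_asymp
  then show ?thesis
    using True by simp
next
  case False
  then have "box_bump a b x = 0"
    using box_bump_pos_iff[of a b x] box_bump_nonneg[of a b x] by linarith
  then show ?thesis
    using False by simp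
qed

lemma bump_quotient_GDERIV:
  fixes a b :: "'a::euclidean_space"
  obtains D where "\<And>x. GDERIV (\<lambda>x. real m * box_bump a b x / (1 + real m * box_bump a b x)) x :> D x"
    "continuous_on UNIV D"
proof -
  obtain D where D: "\<And>x. GDERIV (box_bump a b) x :> D x" "continuous_on UNIV D"
    by (rule box_bump_GDERIV[of a b]) blast
  have pos: "1 + real m * box_bump a b x > 0" for x
    using box_bump_nonneg[of a b x] by (simp add: add_pos_nonneg)
  have "GDERIV (\<lambda>x. real m * box_bump a b x / (1 + real m * box_bump a b x)) x
      :> (real m / (1 + real m * box_bump a b x)\<^sup>2) *\<^sub>R D x" for x
  proof (rule GDERIV_DERIV_compose[OF D(1)])
    show "((\<lambda>y. real m * y / (1 + real m * y)) has_real_derivative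
        real m / (1 + real m * box_bump a b x)\<^sup>2) (at (box_bump a b x))"
      using pos[of x] by (auto intro!: derivative_eq_intros simp: field_simps power2_eq_square)
  qed
  moreover have "continuous_on UNIV (\<lambda>x. (real m / (1 + real m * box_bump a b x)\<^sup>2) *\<^sub>R D x)"
    using pos by (intro continuous_intros GDERIV_continuous_on[OF D(1)] D(2)) (auto simp: less_imp_neq[symmetric])
  ultimately show ?thesis
    by (rule that)
qed

text \<open>The \<open>C\<^sup>1\<close> bumps in \<open>bump_quotient_GDERIV\<close> increase to the indicator of the box.\<close>

lemma weak_gradient_integral_box_eq:
  fixes f :: "real^'n \<Rightarrow> real"
  assumes g1: "has_weak_gradient f g1" and g2: "has_weak_gradient f g2"
  shows "(\<integral>x. indicator (box a b) x *\<^sub>R g1 x \<partial>lborel) = (\<integral>x. indicator (box a b) x *\<^sub>R g2 x \<partial>lborel)"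
proof -
  define \<phi> where "\<phi> m x = real m * box_bump a b x / (1 + real m * box_bump a b x)" for m and x :: "real^'n"
  have out: "\<phi> m x = 0" if "x \<notin> box a b" for m x
    using that box_bump_pos_iff[of a b x] box_bump_nonneg[of a b x] by (auto simp: \<phi>_def)
  have bnd: "norm (\<phi> m x) \<le> 1" for m x
    using box_bump_nonneg[of a b x] mult_nonneg_nonneg[of "real m" "box_bump a b x"]
    by (simp add: \<phi>_def divide_le_eq_1 add_pos_nonneg)
  have \<phi>_D: "\<exists>D. (\<forall>x. GDERIV (\<phi> m) x :> D x) \<and> continuous_on UNIV D" for m
    unfolding \<phi>_def by (rule bump_quotient_GDERIV[of m a b]) blast
  have lim: "(\<lambda>m. \<integral>x. \<phi> m x *\<^sub>R g x \<partial>lborel) \<longlonglongrightarrow> (\<integral>x. indicator (box a b) x *\<^sub>R g x \<partial>lborel)"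
    if "has_weak_gradient f g" for g
  proof -
    \<comment> \<open>\<open>g\<close> is only locally integrable. Cutting it off to the closed box,
      which is compact, gives the integrable majorant; the integrals are unchanged because each
      \<open>\<phi> m\<close> vanishes outside the open box.\<close>
    define G where "G x = indicator (cbox a b) x *\<^sub>R g x" for x
    have int: "integrable lborel G"
      using has_weak_gradient_set_integrable[OF that compact_cbox]
      unfolding set_integrable_def G_def .
    have [measurable]: "\<phi> m \<in> borel_measurable borel" for m
    proof -
      obtain D where "\<And>x. GDERIV (\<phi> m) x :> D x" "continuous_on UNIV D"
        using \<phi>_D[of m] by blast
      from GDERIV_continuous_on[OF this(1)] show ?thesis
        by (rule borel_measurable_continuous_onI)
    qed
    have eq: "\<phi> m x *\<^sub>R g x = \<phi> m x *\<^sub>R G x" for m x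
      using out[of x m] box_subset_cbox[of a b] by (auto simp: indicator_def G_def)
    have eq': "indicator (box a b) x *\<^sub>R g x = indicator (box a b) x *\<^sub>R G x" for x
      using box_subset_cbox[of a b] by (auto simp: indicator_def G_def)
    have [measurable]: "G \<in> borel_measurable borel"
      using borel_measurable_integrable[OF int] by simp
    show "(\<lambda>m. \<integral>x. \<phi> m x *\<^sub>R g x \<partial>lborel) \<longlonglongrightarrow> (\<integral>x. indicator (box a b) x *\<^sub>R g x \<partial>lborel)"
      unfolding eq eq'
    proof (rule integral_dominated_convergence)
      show "integrable lborel (\<lambda>x. norm (G x))"
        by (intro integrable_norm int)
      show "AE x in lborel. (\<lambda>m. \<phi> m x *\<^sub>R G x) \<longlonglongrightarrow>
          indicat_real (box a b) x *\<^sub>R G x"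
        unfolding \<phi>_def by (intro AE_I2 tendsto_scaleR indicator_box_LIMSEQ tendsto_const)
      show "AE x in lborel. norm (\<phi> m x *\<^sub>R G x)
          \<le> norm (G x)" for m
        using bnd[of m] by (intro AE_I2) (simp add: mult_left_le_one_le flip: real_norm_def)
    qed measurable
  qed
  have eq: "(\<integral>x. \<phi> m x *\<^sub>R g1 x \<partial>lborel) = (\<integral>x. \<phi> m x *\<^sub>R g2 x \<partial>lborel)" for m
  proof -
    obtain D where D: "\<And>x. GDERIV (\<phi> m) x :> D x" "continuous_on UNIV D"
      using \<phi>_D[of m] by blast
    have "{x. \<phi> m x \<noteq> 0} \<subseteq> cbox a b"
      using out box_subset_cbox[of a b] by blast
    then have "compact (closure {x. \<phi> m x \<noteq> 0})"
      unfolding compact_closure by (rule bounded_subset[OF bounded_cbox])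
    then have "(\<integral>x. f x *\<^sub>R D x \<partial>lborel) = - (\<integral>x. \<phi> m x *\<^sub>R g1 x \<partial>lborel)"
        "(\<integral>x. f x *\<^sub>R D x \<partial>lborel) = - (\<integral>x. \<phi> m x *\<^sub>R g2 x \<partial>lborel)"
      using has_weak_gradientD[OF g1 D] has_weak_gradientD[OF g2 D] by auto
    then show ?thesis
      by simp
  qed
  show ?thesis
    by (rule LIMSEQ_unique[OF lim[OF g1, unfolded eq] lim[OF g2]])
qed

text \<open>Dynkin argument: open boxes form an intersection-stable generator of the Borel sets. To
  have integrable functions it is run inside the bounded boxes \<open>U N\<close>, countably many of
  which cover the space.\<close>

lemma AE_eq_of_integral_box_eq:
  fixes g1 g2 :: "'a::euclidean_space \<Rightarrow> 'b::{banach, second_countable_topology}"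
  assumes int: "\<And>K. compact K \<Longrightarrow> set_integrable lborel K g1" "\<And>K. compact K \<Longrightarrow> set_integrable lborel K g2"
    and eq: "\<And>a b. (\<integral>x. indicator (box a b) x *\<^sub>R g1 x \<partial>lborel) = (\<integral>x. indicator (box a b) x *\<^sub>R g2 x \<partial>lborel)"
  shows "AE x in lborel. g1 x = g2 x"
proof -
  define U :: "nat \<Rightarrow> 'a set" where "U N = box (- (real N *\<^sub>R One)) (real N *\<^sub>R One)" for N
  have intU: "integrable lborel (\<lambda>x. indicator (U N) x *\<^sub>R g x)"
    if "\<And>K. compact K \<Longrightarrow> set_integrable lborel K g" for N and g :: "'a \<Rightarrow> 'b"
    using set_integrable_subset[OF that[OF compact_cbox] _ box_subset_cbox]
    unfolding set_integrable_def U_def by simp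
  have "AE x in lborel. indicator (U N) x *\<^sub>R g1 x = indicator (U N) x *\<^sub>R g2 x" for N
  proof (rule sigma_finite_measure.density_unique_banach[OF sigma_finite_lborel])
    let ?G = "\<lambda>g x. indicator (U N) x *\<^sub>R g x"
    show i1: "integrable lborel (?G g1)" and i2: "integrable lborel (?G g2)"
      using intU int by auto
    let ?d = "\<lambda>x. ?G g1 x - ?G g2 x"
    have id: "integrable lborel ?d"
      using i1 i2 by simp
    have box0: "set_lebesgue_integral lborel (box a b) ?d = 0" for a b
    proof -
      obtain c e where ce: "box a b \<inter> U N = box c e"
        unfolding U_def using box_Int_box by blast
      have d: "indicator (box a b) x *\<^sub>R ?d x
          = indicator (box c e) x *\<^sub>R g1 x - indicator (box c e) x *\<^sub>R g2 x" for x
        unfolding ce[symmetric] by (auto simp: indicator_def)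
      have G: "indicator (box c e) x *\<^sub>R ?G g x = indicator (box c e) x *\<^sub>R g x" for g :: "'a \<Rightarrow> 'b" and x
        unfolding ce[symmetric] by (auto simp: indicator_def)
      have "integrable lborel (\<lambda>x. indicator (box c e) x *\<^sub>R g1 x)"
        "integrable lborel (\<lambda>x. indicator (box c e) x *\<^sub>R g2 x)"
        using integrable_mult_indicator[OF _ i1, of "box c e"]
          integrable_mult_indicator[OF _ i2, of "box c e"] unfolding G by simp_all
      then show ?thesis
        unfolding set_lebesgue_integral_def d using eq[of c e] by simp
    qed
    \<comment> \<open>Complements in the induction need the integral over the whole space, which is
      not a box; but \<open>?d\<close> vanishes off \<open>U N\<close>, so this integral is one over
      a box.\<close>
    have tot: "integral\<^sup>L lborel ?d = 0"
    proof -
      obtain a b where ab: "U N = box a b"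
        unfolding U_def by blast
      have "set_lebesgue_integral lborel (U N) ?d = integral\<^sup>L lborel ?d"
        unfolding set_lebesgue_integral_def by (intro Bochner_Integration.integral_cong) (auto simp: indicator_def)
      then show ?thesis
        using box0[of a b] unfolding ab[symmetric] by (rule trans[OF sym])
    qed
    have si: "set_integrable lborel A ?d" if "A \<in> sets borel" for A
      unfolding set_integrable_def using integrable_mult_indicator[OF _ id, of A] that by simp
    have sets: "sigma_sets UNIV (range (\<lambda>(a, b). box a b)) = sets (borel :: 'a measure)"
      by (simp add: borel_eq_box)
    have all0: "set_lebesgue_integral lborel A ?d = 0" if "A \<in> sets borel" for A
    proof -
      have "Int_stable (range (\<lambda>(a, b). box a b :: 'a set))"
        by (auto simp: Int_stable_def box_Int_box)
      moreover have "range (\<lambda>(a, b). box a b :: 'a set) \<subseteq> Pow UNIV"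
        by simp
      moreover have "A \<in> sigma_sets UNIV (range (\<lambda>(a, b). box a b))"
        using that unfolding sets .
      ultimately show ?thesis
      proof (induction rule: sigma_sets_induct_disjoint)
        case (compl A)
        then have A: "A \<in> sets borel"
          unfolding sets by simp
        have "indicator (UNIV - A) x *\<^sub>R ?d x = ?d x - indicator A x *\<^sub>R ?d x" for x
          by (auto simp: indicator_def)
        then show ?case
          using compl.IH tot id si[OF A] unfolding set_lebesgue_integral_def set_integrable_def by simp
      next
        case (union A)
        then have A: "A i \<in> sets borel" for i
          unfolding sets by auto
        have "set_lebesgue_integral lborel (\<Union>i. A i) ?d = (\<Sum>i. set_lebesgue_integral lborel (A i) ?d)"
          by (rule lebesgue_integral_countable_add)
            (use A si union(1) in \<open>auto simp: disjoint_family_on_def\<close>)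
        then show ?case
          using union.IH by simp
      next
        case (basic A)
        then show ?case
          using box0 by auto
      next
        case empty
        show ?case
          by (simp add: set_lebesgue_integral_def)
      qed
    qed
    show "set_lebesgue_integral lborel A (?G g1) = set_lebesgue_integral lborel A (?G g2)"
      if "A \<in> sets lborel" for A
    proof -
      have "set_lebesgue_integral lborel A ?d
          = set_lebesgue_integral lborel A (?G g1) - set_lebesgue_integral lborel A (?G g2)"
        by (rule set_integral_diff; unfold set_integrable_def, intro integrable_mult_indicator that i1 i2)
      then show ?thesis
        using all0[of A] that by simp
    qed
  qed
  then have "AE x in lborel. \<forall>N. indicator (U N) x *\<^sub>R g1 x = indicator (U N) x *\<^sub>R g2 x"
    unfolding AE_all_countable by (rule allI)
  then show ?thesis
  proof (rule AE_mp, intro AE_I2 impI)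
    fix x assume *: "\<forall>N. indicator (U N) x *\<^sub>R g1 x = indicator (U N) x *\<^sub>R g2 x"
    have "x \<in> (\<Union>N. U N)"
      unfolding U_def UN_box_eq_UNIV by simp
    then obtain N where "x \<in> U N"
      by blast
    then show "g1 x = g2 x"
      using *[rule_format, of N] by simp
  qed
qed

lemma has_weak_gradient_unique:
  assumes "has_weak_gradient f g1" "has_weak_gradient f g2"
  shows "AE x in lborel. g1 x = g2 x"
  by (intro AE_eq_of_integral_box_eq weak_gradient_integral_box_eq[of f] has_weak_gradient_set_integrable[of f] assms)

section \<open>The Gaussian measure and its translates\<close>

lemma sets_std_gaussian [simp, measurable_cong]: "sets (std_gaussian :: (real^'n) measure) = sets borel"
  by (simp add: std_gaussian_def)

lemma space_std_gaussian [simp]: "space (std_gaussian :: (real^'n) measure) = UNIV"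
  by (simp add: std_gaussian_def)

definition gaussian_density :: "real^'n \<Rightarrow> real" where
  "gaussian_density x = (2 * pi) powr (- real CARD('n) / 2) * exp (- (norm x)\<^sup>2 / 2)"

lemma gaussian_density_pos: "gaussian_density x > 0"
  by (simp add: gaussian_density_def)

lemma gaussian_density_measurable [measurable]: "gaussian_density \<in> borel_measurable borel"
  unfolding gaussian_density_def[abs_def] by measurable

lemma std_gaussian_eq: "std_gaussian = density lborel (\<lambda>x. ennreal (gaussian_density x))"
  by (simp add: std_gaussian_def gaussian_density_def)

lemma norm_square_eq_sum_Basis: "(norm x)\<^sup>2 = (\<Sum>b\<in>Basis. (x \<bullet> b)\<^sup>2)"
  unfolding power2_norm_eq_inner by (subst euclidean_inner) (simp add: power2_eq_square)

text \<open>Gives access to Tonelli: Gaussian integrals of products over coordinates reduce to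
  one-dimensional moments of \<open>std_normal_density\<close>.\<close>

lemma gaussian_density_eq_prod:
  "gaussian_density (x :: real^'n) = (\<Prod>b\<in>Basis. std_normal_density (x \<bullet> b))"
proof -
  have "exp (- (norm x)\<^sup>2 / 2) = exp (\<Sum>b\<in>Basis. - (x \<bullet> b)\<^sup>2 / 2)"
    unfolding norm_square_eq_sum_Basis by (simp add: sum_divide_distrib sum_negf)
  also have "\<dots> = (\<Prod>b\<in>Basis. exp (- (x \<bullet> b)\<^sup>2 / 2))"
    by (rule exp_sum) (rule finite_Basis)
  finally have "exp (- (norm x)\<^sup>2 / 2) = (\<Prod>b\<in>Basis. exp (- (x \<bullet> b)\<^sup>2 / 2))" .
  moreover have "(2 * pi) powr (- real CARD('n) / 2) = (\<Prod>b\<in>(Basis :: (real^'n) set). 1 / sqrt (2 * pi))"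
  proof -
    have "(2 * pi) powr (- real CARD('n) / 2) = ((2 * pi) powr (- (1 / 2))) powr (real CARD('n))"
      by (simp add: powr_powr)
    also have "(2 * pi) powr (- (1 / 2)) = 1 / sqrt (2 * pi)"
      unfolding powr_minus by (subst powr_half_sqrt) (simp_all only: inverse_eq_divide, simp)
    finally show ?thesis
      by (simp add: powr_realpow)
  qed
  ultimately show ?thesis
    by (simp add: gaussian_density_def std_normal_density_def prod.distrib[symmetric] del: prod_constant)
qed

lemma nn_integral_std_gaussian:
  assumes [measurable]: "h \<in> borel_measurable borel"
  shows "(\<integral>\<^sup>+x. h x \<partial>std_gaussian) = (\<integral>\<^sup>+x. ennreal (gaussian_density x) * h x \<partial>lborel)"
  unfolding std_gaussian_eq by (subst nn_integral_density) auto

lemma nn_integral_std_gaussian_prod: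
  fixes f :: "real^'n \<Rightarrow> real \<Rightarrow> ennreal"
  assumes [measurable]: "\<And>b. f b \<in> borel_measurable borel"
  shows "(\<integral>\<^sup>+x. (\<Prod>b\<in>Basis. f b (x \<bullet> b)) \<partial>std_gaussian)
    = (\<Prod>b\<in>Basis. \<integral>\<^sup>+y. ennreal (std_normal_density y) * f b y \<partial>lborel)"
proof -
  have "(\<integral>\<^sup>+x. (\<Prod>b\<in>Basis. f b (x \<bullet> b)) \<partial>std_gaussian)
      = (\<integral>\<^sup>+x. (\<Prod>b\<in>Basis. ennreal (std_normal_density (x \<bullet> b)) * f b (x \<bullet> b)) \<partial>lborel)"
    by (subst nn_integral_std_gaussian)
      (auto simp: gaussian_density_eq_prod prod.distrib prod_ennreal)
  also have "\<dots> = (\<Prod>b\<in>Basis. \<integral>\<^sup>+y. ennreal (std_normal_density y) * f b y \<partial>lborel)"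
    by (rule nn_integral_lborel_prod) auto
  finally show ?thesis .
qed

lemma nn_integral_std_normal_density: "(\<integral>\<^sup>+y. ennreal (std_normal_density y) \<partial>lborel) = 1"
  using nn_integral_eq_integral[of lborel std_normal_density] by simp

lemma nn_integral_std_normal_density_square:
  "(\<integral>\<^sup>+y. ennreal (std_normal_density y) * ennreal (y\<^sup>2) \<partial>lborel) = 1"
proof -
  have "has_bochner_integral lborel (\<lambda>y. std_normal_density y * y\<^sup>2) 1"
    using std_normal_moment_even[of 1] by simp
  then have "(\<integral>\<^sup>+y. ennreal (std_normal_density y * y\<^sup>2) \<partial>lborel) = 1"
    by (subst nn_integral_eq_integral) (auto simp: has_bochner_integral_iff)
  then show ?thesis
    by (simp add: ennreal_mult')
qed

lemma prob_space_std_gaussian: "prob_space (std_gaussian :: (real^'n) measure)"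
proof
  have "emeasure (std_gaussian :: (real^'n) measure) UNIV
      = (\<integral>\<^sup>+x. (\<Prod>b\<in>(Basis :: (real^'n) set). 1) \<partial>(std_gaussian :: (real^'n) measure))"
    by simp
  also have "\<dots> = 1"
    by (subst nn_integral_std_gaussian_prod) (auto simp: nn_integral_std_normal_density)
  finally show "emeasure (std_gaussian :: (real^'n) measure) (space std_gaussian) = 1"
    by simp
qed

lemma second_moment_std_gaussian:
  "second_moment (std_gaussian :: (real^'n) measure) = ennreal (real CARD('n))"
proof -
  have 1: "(\<integral>\<^sup>+x. ennreal ((x \<bullet> i)\<^sup>2) \<partial>(std_gaussian :: (real^'n) measure)) = 1"
    if i: "i \<in> Basis" for i
  proof -
    \<comment> \<open>Padding with factors 1 brings the integrand into product form; each coordinate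
      other than \<open>i\<close> then contributes only the total mass 1.\<close>
    have "ennreal ((x \<bullet> i)\<^sup>2) = (\<Prod>b\<in>Basis. if b = i then ennreal ((x \<bullet> b)\<^sup>2) else 1)" for x
      using i by (subst prod.delta) auto
    then have "(\<integral>\<^sup>+x. ennreal ((x \<bullet> i)\<^sup>2) \<partial>(std_gaussian :: (real^'n) measure))
        = (\<Prod>b\<in>Basis. \<integral>\<^sup>+y. ennreal (std_normal_density y) * (if b = i then ennreal (y\<^sup>2) else 1) \<partial>lborel)"
      using nn_integral_std_gaussian_prod[of "\<lambda>b y. if b = i then ennreal (y\<^sup>2) else 1"] by simp
    also have "\<dots> = (\<Prod>b\<in>(Basis :: (real^'n) set). 1)"
    proof (intro prod.cong refl)
      fix b :: "real^'n"
      show "(\<integral>\<^sup>+y. ennreal (std_normal_density y) * (if b = i then ennreal (y\<^sup>2) else 1) \<partial>lborel) = 1"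
        by (cases "b = i")
          (simp_all only: if_True if_False mult_1_right nn_integral_std_normal_density
            nn_integral_std_normal_density_square refl)
    qed
    finally show ?thesis
      by simp
  qed
  have "ennreal ((norm x)\<^sup>2) = (\<Sum>b\<in>Basis. ennreal ((x \<bullet> b)\<^sup>2))" for x :: "real^'n"
    unfolding norm_square_eq_sum_Basis by (rule sum_ennreal[symmetric]) simp
  then have "second_moment (std_gaussian :: (real^'n) measure)
      = (\<Sum>b\<in>(Basis :: (real^'n) set). \<integral>\<^sup>+x. ennreal ((x \<bullet> b)\<^sup>2) \<partial>std_gaussian)"
    unfolding second_moment_def by (subst nn_integral_sum[symmetric]) auto
  also have "\<dots> = (\<Sum>b\<in>(Basis :: (real^'n) set). 1)"
    using 1 by (intro sum.cong) auto
  finally show ?thesis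
    by (simp add: ennreal_of_nat_eq_real_of_nat)
qed

interpretation gaussian: prob_space "std_gaussian :: (real^'n) measure"
  by (rule prob_space_std_gaussian)

lemma integrable_std_gaussian_norm_square:
  "integrable (std_gaussian :: (real^'n) measure) (\<lambda>x. (norm x)\<^sup>2)"
proof (rule integrableI_nonneg)
  show "(\<integral>\<^sup>+x. ennreal ((norm x)\<^sup>2) \<partial>(std_gaussian :: (real^'n) measure)) < \<infinity>"
    using second_moment_std_gaussian[where 'n='n] by (simp add: second_moment_def)
qed auto

lemma integrable_std_gaussian_id: "integrable (std_gaussian :: (real^'n) measure) (\<lambda>x. x)"
proof (rule Bochner_Integration.integrable_bound)
  show "integrable (std_gaussian :: (real^'n) measure) (\<lambda>x. 1 + (norm x)\<^sup>2)"
    by (intro Bochner_Integration.integrable_add gaussian.integrable_const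
        integrable_std_gaussian_norm_square)
  have "y \<le> 1 + y\<^sup>2" for y :: real
    using sum_squares_ge_zero[of "y - 1" 0] zero_le_power2[of y] by (simp add: power2_eq_square algebra_simps)
      (smt (verit) zero_le_square)
  then show "AE x in std_gaussian. norm (x :: real^'n) \<le> norm (1 + (norm x)\<^sup>2)"
    by (simp add: abs_of_nonneg)
qed auto

text \<open>The integrand is odd and Lebesgue measure is invariant under reflection at 0, so the
  integral equals its own negative.\<close>

lemma integral_std_gaussian_id: "(\<integral>x. x \<partial>std_gaussian) = (0 :: real^'n)"
proof -
  let ?h = "\<lambda>x :: real^'n. gaussian_density x *\<^sub>R x"
  have "(lborel :: (real^'n) measure) = distr lborel borel uminus"
    using lborel_affine[of "-1" "0 :: real^'n"] by (simp add: density_1 cong: distr_cong)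
  then have "(\<integral>x. ?h x \<partial>lborel) = (\<integral>x. ?h x \<partial>distr lborel borel uminus)"
    by simp
  also have "\<dots> = (\<integral>x. - ?h x \<partial>lborel)"
    by (subst integral_distr) (auto simp: gaussian_density_def)
  finally have "(\<integral>x. ?h x \<partial>lborel) = - (\<integral>x. ?h x \<partial>lborel)"
    by (simp only: integral_minus)
  then have "2 *\<^sub>R (\<integral>x. ?h x \<partial>lborel) = 0"
    unfolding scaleR_2 by (rule eq_neg_iff_add_eq_0[THEN iffD1])
  then have "(\<integral>x. ?h x \<partial>lborel) = 0"
    by (simp only: scaleR_eq_0_iff zero_neq_numeral[symmetric] simp_thms)
  then show ?thesis
    unfolding std_gaussian_eq by (subst integral_density) (auto simp: gaussian_density_pos less_imp_le)
qed

text \<open>By the Cameron-Martin formula the exponential tilts below are the densities of the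
  translated Gaussians.\<close>

definition tilt :: "real^'n \<Rightarrow> real^'n \<Rightarrow> real" where
  "tilt v x = exp (v \<bullet> x - (norm v)\<^sup>2 / 2)"

lemma tilt_pos: "tilt v x > 0"
  by (simp add: tilt_def)

lemma ln_tilt: "ln (tilt v x) = v \<bullet> x - (norm v)\<^sup>2 / 2"
  by (simp add: tilt_def)

lemma tilt_measurable [measurable]: "tilt v \<in> borel_measurable borel"
  unfolding tilt_def[abs_def] by measurable

text \<open>The linear parts of the exponents cancel, so the product of the two bumps is constant in
  \<open>x\<close>. This constant is the overlap of the bumps in the Fisher information.\<close>

lemma tilt_mult_tilt_uminus: "tilt v x * tilt (- v) x = exp (- (norm v)\<^sup>2)"
  by (simp add: tilt_def flip: exp_add)

text \<open>A power of a tilt is a tilt up to a constant, so its integral is that constant. The sign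
  of a (a - 1) decides its size: a = 1/2 gives the small overlap terms of the Fisher information, a
  = p > 1 the large factor in the L^p bound.\<close>

lemma tilt_powr: "tilt v x powr a = exp (a * (a - 1) * (norm v)\<^sup>2 / 2) * tilt (a *\<^sub>R v) x"
  by (simp add: tilt_def powr_def power_mult_distrib algebra_simps power2_eq_square add_divide_distrib
      diff_divide_distrib flip: exp_add)

lemma gaussian_density_translate: "gaussian_density (x - v) = gaussian_density x * tilt v x"
  by (simp add: gaussian_density_def tilt_def power2_norm_eq_inner inner_diff_left inner_diff_right
      inner_commute algebra_simps add_divide_distrib diff_divide_distrib flip: exp_add)

lemma nn_integral_tilt:
  assumes [measurable]: "h \<in> borel_measurable borel"
  shows "(\<integral>\<^sup>+x. ennreal (tilt v x) * h x \<partial>std_gaussian) = (\<integral>\<^sup>+x. h (x + v) \<partial>std_gaussian)"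
proof -
  have "(\<integral>\<^sup>+x. ennreal (tilt v x) * h x \<partial>std_gaussian)
      = (\<integral>\<^sup>+x. ennreal (gaussian_density (x - v)) * h x \<partial>lborel)"
    by (subst nn_integral_std_gaussian)
      (auto simp: gaussian_density_translate ennreal_mult gaussian_density_pos tilt_pos less_imp_le mult.assoc)
  also have "\<dots> = (\<integral>\<^sup>+x. ennreal (gaussian_density (x - v)) * h x \<partial>distr lborel borel ((+) v))"
    by (simp add: lborel_distr_plus)
  also have "\<dots> = (\<integral>\<^sup>+x. ennreal (gaussian_density x) * h (x + v) \<partial>lborel)"
    by (subst nn_integral_distr) (auto simp: add.commute)
  also have "\<dots> = (\<integral>\<^sup>+x. h (x + v) \<partial>std_gaussian)"
    by (subst nn_integral_std_gaussian) auto
  finally show ?thesis .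
qed

lemma density_tilt: "density std_gaussian (\<lambda>x. ennreal (tilt v x)) = distr std_gaussian borel (\<lambda>x. x + v)"
proof (rule measure_eqI)
  fix A assume "A \<in> sets (density std_gaussian (\<lambda>x. ennreal (tilt v x)))"
  then have [measurable]: "A \<in> sets borel"
    by simp
  have "emeasure (density std_gaussian (\<lambda>x. ennreal (tilt v x))) A
      = (\<integral>\<^sup>+x. ennreal (tilt v x) * indicator A x \<partial>std_gaussian)"
    by (subst emeasure_density) auto
  also have "\<dots> = (\<integral>\<^sup>+x. indicator A (x + v) \<partial>std_gaussian)"
    by (rule nn_integral_tilt) auto
  also have "\<dots> = (\<integral>\<^sup>+x. indicator A x \<partial>distr std_gaussian borel (\<lambda>x. x + v))"
    by (subst nn_integral_distr) auto
  finally show "emeasure (density std_gaussian (\<lambda>x. ennreal (tilt v x))) A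
      = emeasure (distr std_gaussian borel (\<lambda>x. x + v)) A"
    by simp
qed simp

lemma
  fixes h :: "real^'n \<Rightarrow> 'b::{banach, second_countable_topology}"
  assumes [measurable]: "h \<in> borel_measurable borel"
  shows integrable_tilt_iff:
      "integrable std_gaussian (\<lambda>x. tilt v x *\<^sub>R h x) \<longleftrightarrow> integrable std_gaussian (\<lambda>x. h (x + v))"
    and integral_tilt: "(\<integral>x. tilt v x *\<^sub>R h x \<partial>std_gaussian) = (\<integral>x. h (x + v) \<partial>std_gaussian)"
proof -
  have "integrable std_gaussian (\<lambda>x. tilt v x *\<^sub>R h x)
      \<longleftrightarrow> integrable (density std_gaussian (\<lambda>x. ennreal (tilt v x))) h"
    by (subst integrable_density) (auto simp: tilt_pos less_imp_le)
  also have "\<dots> \<longleftrightarrow> integrable std_gaussian (\<lambda>x. h (x + v))"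
    unfolding density_tilt by (subst integrable_distr_eq) auto
  finally show "integrable std_gaussian (\<lambda>x. tilt v x *\<^sub>R h x) \<longleftrightarrow> integrable std_gaussian (\<lambda>x. h (x + v))" .
  have "(\<integral>x. tilt v x *\<^sub>R h x \<partial>std_gaussian) = integral\<^sup>L (density std_gaussian (\<lambda>x. ennreal (tilt v x))) h"
    by (subst integral_density) (auto simp: tilt_pos less_imp_le)
  also have "\<dots> = (\<integral>x. h (x + v) \<partial>std_gaussian)"
    unfolding density_tilt by (subst integral_distr) auto
  finally show "(\<integral>x. tilt v x *\<^sub>R h x \<partial>std_gaussian) = (\<integral>x. h (x + v) \<partial>std_gaussian)" .
qed

lemma has_bochner_integral_tilt: "has_bochner_integral std_gaussian (tilt v) 1"
  using integrable_tilt_iff[of "\<lambda>x. 1 :: real" v] integral_tilt[of "\<lambda>x. 1 :: real" v]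
  by (simp add: has_bochner_integral_iff gaussian.prob_space[simplified])

lemma has_bochner_integral_tilt_id: "has_bochner_integral std_gaussian (\<lambda>x. tilt v x *\<^sub>R x) v"
proof -
  have "has_bochner_integral std_gaussian (\<lambda>x. x + v) (0 + v)"
    by (rule has_bochner_integral_add)
      (use integrable_std_gaussian_id integral_std_gaussian_id in
        \<open>auto simp: has_bochner_integral_iff gaussian.prob_space[simplified]\<close>)
  then show ?thesis
    by (simp add: has_bochner_integral_iff integrable_tilt_iff[of "\<lambda>x. x"] integral_tilt[of "\<lambda>x. x"])
qed

text \<open>The logarithm of a tilt is affine, so its mean under the translated Gaussian depends
  only on the barycenter v and equals v . v - |v|^2 / 2.\<close>

lemma has_bochner_integral_tilt_ln:
  "has_bochner_integral std_gaussian (\<lambda>x. tilt v x * ln (tilt v x)) ((norm v)\<^sup>2 / 2)"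
proof -
  have "has_bochner_integral std_gaussian
      (\<lambda>x. v \<bullet> (tilt v x *\<^sub>R x) - (norm v)\<^sup>2 / 2 * tilt v x) (v \<bullet> v - (norm v)\<^sup>2 / 2 * 1)"
    by (intro has_bochner_integral_diff has_bochner_integral_inner_right
        has_bochner_integral_mult_right has_bochner_integral_tilt has_bochner_integral_tilt_id)
  then show ?thesis
    by (simp add: ln_tilt right_diff_distrib power2_norm_eq_inner[symmetric] mult.commute)
qed

section \<open>The Gaussian mixtures\<close>

lemma has_bochner_integral_tilt_norm_square:
  fixes v :: "real^'n"
  shows "has_bochner_integral std_gaussian (\<lambda>x. tilt v x * (norm x)\<^sup>2) (real CARD('n) + (norm v)\<^sup>2)"
proof -
  have sq: "has_bochner_integral std_gaussian (\<lambda>x. (norm (x :: real^'n))\<^sup>2) (real CARD('n))"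
  proof (rule has_bochner_integral_nn_integral)
    show "(\<integral>\<^sup>+x. ennreal ((norm (x :: real^'n))\<^sup>2) \<partial>std_gaussian) = ennreal (real CARD('n))"
      using second_moment_std_gaussian[where 'n='n] by (simp add: second_moment_def)
  qed auto
  have id: "has_bochner_integral std_gaussian (\<lambda>x. x) (0 :: real^'n)"
    by (simp add: has_bochner_integral_iff integrable_std_gaussian_id integral_std_gaussian_id)
  have const: "has_bochner_integral (std_gaussian :: (real^'n) measure) (\<lambda>x. (norm v)\<^sup>2) ((norm v)\<^sup>2)"
    by (simp add: has_bochner_integral_iff gaussian.prob_space[simplified])
  have "has_bochner_integral std_gaussian (\<lambda>x. (norm x)\<^sup>2 + 2 * (v \<bullet> x) + (norm v)\<^sup>2)
      (real CARD('n) + 2 * (v \<bullet> 0) + (norm v)\<^sup>2)"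
    by (intro has_bochner_integral_add has_bochner_integral_mult_right
        has_bochner_integral_inner_right sq id const)
  moreover have "(norm x)\<^sup>2 + 2 * (v \<bullet> x) + (norm v)\<^sup>2 = (norm (x + v))\<^sup>2" for x
    by (simp add: power2_norm_eq_inner inner_add_left inner_add_right inner_commute)
  ultimately have "has_bochner_integral std_gaussian (\<lambda>x. (norm (x + v))\<^sup>2) (real CARD('n) + (norm v)\<^sup>2)"
    by simp
  then show ?thesis
    using integrable_tilt_iff[of "\<lambda>x. (norm x)\<^sup>2" v] integral_tilt[of "\<lambda>x. (norm x)\<^sup>2" v]
    by (simp add: has_bochner_integral_iff)
qed

definition mix :: "real \<Rightarrow> real^'n \<Rightarrow> real^'n \<Rightarrow> real" where
  "mix t v x = (1 - 2 * t) + t * (tilt v x + tilt (- v) x)"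

lemma mix_measurable [measurable]: "mix t v \<in> borel_measurable borel"
  unfolding mix_def[abs_def] by measurable

text \<open>The central component is written as \<open>tilt 0\<close>, the constant 1, so that the
  same integral formulas for tilts serve all three components.\<close>

lemma has_bochner_integral_mix_scaleR:
  fixes h :: "real^'n \<Rightarrow> 'b::{banach, second_countable_topology}"
  assumes "has_bochner_integral std_gaussian (\<lambda>x. tilt 0 x *\<^sub>R h x) a"
    and "has_bochner_integral std_gaussian (\<lambda>x. tilt v x *\<^sub>R h x) b"
    and "has_bochner_integral std_gaussian (\<lambda>x. tilt (- v) x *\<^sub>R h x) c"
  shows "has_bochner_integral std_gaussian (\<lambda>x. mix t v x *\<^sub>R h x) ((1 - 2 * t) *\<^sub>R a + t *\<^sub>R (b + c))"
proof -
  have "has_bochner_integral std_gaussian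
      (\<lambda>x. (1 - 2 * t) *\<^sub>R (tilt 0 x *\<^sub>R h x) + t *\<^sub>R (tilt v x *\<^sub>R h x + tilt (- v) x *\<^sub>R h x))
      ((1 - 2 * t) *\<^sub>R a + t *\<^sub>R (b + c))"
    by (intro has_bochner_integral_add has_bochner_integral_scaleR_right assms)
  then show ?thesis
    by (simp add: mix_def tilt_def algebra_simps)
qed

lemma has_bochner_integral_mix: "has_bochner_integral std_gaussian (mix t v) 1"
  using has_bochner_integral_mix_scaleR[of "\<lambda>x. 1 :: real" 1 v 1 1 t]
    has_bochner_integral_tilt[of 0] has_bochner_integral_tilt[of v] has_bochner_integral_tilt[of "- v"]
  by simp

lemma has_bochner_integral_mix_id: "has_bochner_integral std_gaussian (\<lambda>x. mix t v x *\<^sub>R x) 0"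
  using has_bochner_integral_mix_scaleR[OF has_bochner_integral_tilt_id has_bochner_integral_tilt_id[of v]
      has_bochner_integral_tilt_id]
  by simp

lemma has_bochner_integral_mix_norm_square:
  fixes v :: "real^'n"
  shows "has_bochner_integral std_gaussian (\<lambda>x. mix t v x * (norm x)\<^sup>2) (real CARD('n) + 2 * t * (norm v)\<^sup>2)"
  using has_bochner_integral_mix_scaleR[of "\<lambda>x. (norm x)\<^sup>2", unfolded real_scaleR_def,
      OF has_bochner_integral_tilt_norm_square has_bochner_integral_tilt_norm_square[of v]
      has_bochner_integral_tilt_norm_square, of t]
  by (simp add: algebra_simps)

section \<open>Entropy and Fisher information squeezed between integrable functions\<close>

lemma relative_entropy_bounds:
  assumes "integrable std_gaussian l" "integrable std_gaussian u"
    and le: "\<And>x. l x \<le> f x * ln (f x)" "\<And>x. f x * ln (f x) \<le> u x"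
    and [measurable]: "f \<in> borel_measurable borel"
  obtains H where "relative_entropy f = ereal H"
    "(\<integral>x. l x \<partial>std_gaussian) \<le> H" "H \<le> (\<integral>x. u x \<partial>std_gaussian)"
proof
  \<comment> \<open>The two envelopes also give integrability, which selects the finite branch of
    \<open>relative_entropy\<close>.\<close>
  have int: "integrable std_gaussian (\<lambda>x. f x * ln (f x))"
  proof (rule Bochner_Integration.integrable_bound)
    show "integrable std_gaussian (\<lambda>x. \<bar>l x\<bar> + \<bar>u x\<bar>)"
      using assms by simp
    have "\<bar>f x * ln (f x)\<bar> \<le> \<bar>l x\<bar> + \<bar>u x\<bar>" for x
      using le[of x] by linarith
    then show "AE x in std_gaussian. norm (f x * ln (f x)) \<le> norm (\<bar>l x\<bar> + \<bar>u x\<bar>)"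
      by simp
  qed measurable
  show "relative_entropy f = ereal (\<integral>x. f x * ln (f x) \<partial>std_gaussian)"
    using int by (simp add: relative_entropy_def)
  show "(\<integral>x. l x \<partial>std_gaussian) \<le> (\<integral>x. f x * ln (f x) \<partial>std_gaussian)"
    by (rule integral_mono) (use assms int in auto)
  show "(\<integral>x. f x * ln (f x) \<partial>std_gaussian) \<le> (\<integral>x. u x \<partial>std_gaussian)"
    by (rule integral_mono) (use assms int in auto)
qed

text \<open>The Gaussian has a density with respect to Lebesgue measure, so uniqueness up to
  Lebesgue null sets is enough to put the classical gradient under Gaussian integrals.\<close>

lemma weak_gradient_AE_eq:
  assumes "\<And>x. GDERIV f x :> f' x" "continuous_on UNIV f'"
  shows "AE x in std_gaussian. weak_gradient f x = f' x"
proof -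
  have "has_weak_gradient f f'"
    using has_weak_gradient_C1 assms .
  then have "AE x in lborel. weak_gradient f x = f' x"
    by (metis has_weak_gradient_unique someI weak_gradient_def)
  then show ?thesis
    unfolding std_gaussian_eq by (subst AE_density) auto
qed

text \<open>The envelope \<open>u\<close> makes the information finite, hence a real number that can
  be compared with the entropy in \<open>deficit\<close>.\<close>

lemma fisher_information_bounds:
  assumes f: "\<And>x. GDERIV f x :> f' x" "continuous_on UNIV f'" and pos: "\<And>x. f x > 0"
    and l: "integrable std_gaussian l" and u: "integrable std_gaussian u"
    and le: "\<And>x. l x \<le> (norm (f' x))\<^sup>2 / f x" "\<And>x. (norm (f' x))\<^sup>2 / f x \<le> u x"
  obtains I where "fisher_information f = ennreal I" "0 \<le> I"
    "(\<integral>x. l x \<partial>std_gaussian) \<le> I" "I \<le> (\<integral>x. u x \<partial>std_gaussian)"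
proof
  have [measurable]: "f' \<in> borel_measurable borel" "f \<in> borel_measurable borel"
    by (rule borel_measurable_continuous_onI; use f(2) GDERIV_continuous_on[OF f(1)] in simp)+
  have nn: "0 \<le> (norm (f' x))\<^sup>2 / f x" for x
    using pos[of x] by simp
  have int: "integrable std_gaussian (\<lambda>x. (norm (f' x))\<^sup>2 / f x)"
  proof (rule Bochner_Integration.integrable_bound[OF u])
    have "norm ((norm (f' x))\<^sup>2 / f x) \<le> norm (u x)" for x
      using nn[of x] le(2)[of x] by simp
    then show "AE x in std_gaussian. norm ((norm (f' x))\<^sup>2 / f x) \<le> norm (u x)"
      by simp
  qed measurable
  have "fisher_information f = (\<integral>\<^sup>+x. ennreal ((norm (weak_gradient f x))\<^sup>2 / f x) \<partial>std_gaussian)"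
    using has_weak_gradient_C1[OF f] unfolding fisher_information_def by auto
  also have "\<dots> = (\<integral>\<^sup>+x. ennreal ((norm (f' x))\<^sup>2 / f x) \<partial>std_gaussian)"
    by (rule nn_integral_cong_AE) (use weak_gradient_AE_eq[OF f] in \<open>auto elim!: AE_mp\<close>)
  also have "\<dots> = ennreal (\<integral>x. (norm (f' x))\<^sup>2 / f x \<partial>std_gaussian)"
    by (rule nn_integral_eq_integral[OF int]) (simp add: nn)
  finally show "fisher_information f = ennreal (\<integral>x. (norm (f' x))\<^sup>2 / f x \<partial>std_gaussian)" .
  show "0 \<le> (\<integral>x. (norm (f' x))\<^sup>2 / f x \<partial>std_gaussian)"
    by (rule Bochner_Integration.integral_nonneg) (rule nn)
  show "(\<integral>x. l x \<partial>std_gaussian) \<le> (\<integral>x. (norm (f' x))\<^sup>2 / f x \<partial>std_gaussian)"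
    by (rule integral_mono[OF l int]) (rule le)
  show "(\<integral>x. (norm (f' x))\<^sup>2 / f x \<partial>std_gaussian) \<le> (\<integral>x. u x \<partial>std_gaussian)"
    by (rule integral_mono[OF int u]) (rule le)
qed

section \<open>Deficit of the mixtures\<close>

lemma mix_GDERIV: "GDERIV (mix t v) x :> (t * (tilt v x - tilt (- v) x)) *\<^sub>R v"
proof -
  have d: "GDERIV (tilt w) x :> tilt w x *\<^sub>R w" for w
    unfolding gderiv_def tilt_def by (auto intro!: derivative_eq_intros simp: inner_commute)
  have "((\<lambda>x. 1 - 2 * t + t * (tilt v x + tilt (- v) x)) has_derivative
      (\<lambda>h. t * (h \<bullet> (tilt v x *\<^sub>R v) + h \<bullet> (tilt (- v) x *\<^sub>R (- v))))) (at x)"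
    using d[unfolded gderiv_def] by (auto intro!: derivative_eq_intros)
  then show ?thesis
    unfolding gderiv_def mix_def[abs_def] by (simp add: algebra_simps)
qed

text \<open>With \<open>u = t (A + B)\<close> and \<open>c = 1 - 2 t\<close> one has \<open>t\<^sup>2 (A - B)\<^sup>2 = u\<^sup>2 - 4 t\<^sup>2 A B\<close> and
  \<open>u\<^sup>2 / (c + u) = u - c u / (c + u)\<close>, where \<open>c u / (c + u) \<le> sqrt u / 2\<close> because \<open>c \<le> 1\<close>.\<close>

lemma mix_fisher_lower:
  fixes A B t :: real
  assumes t: "0 < t" "t < 1 / 2" and A: "A > 0" and B: "B > 0"
  shows "t * (A + B) - sqrt t * (sqrt A + sqrt B) / 2 - 4 * t\<^sup>2 * (A * B) / (1 - 2 * t)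
    \<le> (t * (A - B))\<^sup>2 / (1 - 2 * t + t * (A + B))"
proof -
  define u c where "u = t * (A + B)" and "c = 1 - 2 * t"
  have u: "u > 0" and c: "c > 0" "c \<le> 1"
    using assms by (auto simp: u_def c_def)
  \<comment> \<open>AM-GM together with c^2 \<le> c: 2 c sqrt u \<le> c^2 + u \<le> c + u.
    Multiplying by sqrt u gives the bound on c u / (c + u).\<close>
  have "c * c \<le> c"
    using c by (simp add: mult_left_le)
  moreover have "(c - sqrt u)\<^sup>2 \<ge> 0"
    by simp
  ultimately have "2 * c * sqrt u \<le> c + u"
    using u by (simp add: power2_diff power2_eq_square[of c])
  then have "sqrt u * (2 * c * sqrt u) \<le> sqrt u * (c + u)"
    by (intro mult_left_mono) (use u in auto)
  also have "sqrt u * (2 * c * sqrt u) = 2 * (c * u)"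
    using u by (simp add: power2_eq_square[symmetric])
  finally have cu: "c * u / (c + u) \<le> sqrt u / 2"
    using u c by (simp add: pos_divide_le_eq)
  \<comment> \<open>Subadditivity of the square root separates the two bumps; square roots of single
    tilts have explicit Gaussian integrals.\<close>
  have su: "sqrt u \<le> sqrt t * (sqrt A + sqrt B)"
    using sqrt_add_le_add_sqrt[of A B] A B t by (simp add: u_def real_sqrt_mult)
  \<comment> \<open>Dropping \<open>u\<close> from the denominator turns the overlap term into a
    constant once A B is constant.\<close>
  have "4 * t\<^sup>2 * (A * B) / (c + u) \<le> 4 * t\<^sup>2 * (A * B) / c"
    using u c A B t by (intro divide_left_mono) auto
  moreover have "(t * (A - B))\<^sup>2 / (c + u) = u - c * u / (c + u) - 4 * t\<^sup>2 * (A * B) / (c + u)"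
  proof -
    have "(t * (A - B))\<^sup>2 = u * (c + u) - c * u - 4 * t\<^sup>2 * (A * B)"
      by (simp add: u_def power2_eq_square algebra_simps)
    then show ?thesis
      using u c by (simp add: diff_divide_distrib)
  qed
  ultimately show ?thesis
    using cu su unfolding u_def[symmetric] c_def[symmetric] by linarith
qed

text \<open>Since |A - B| \<le> A + B, the numerator is at most the square of t (A + B), while the
  denominator is at least t (A + B).\<close>

lemma mix_fisher_upper:
  fixes A B t :: real
  assumes t: "0 < t" "t < 1 / 2" and A: "A > 0" and B: "B > 0"
  shows "(t * (A - B))\<^sup>2 / (1 - 2 * t + t * (A + B)) \<le> t * (A + B)"
proof -
  have "(t * (A - B))\<^sup>2 \<le> (t * (A + B))\<^sup>2"
    using assms by (intro power2_le_iff_abs_le[THEN iffD2]) (auto simp: abs_mult)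
  also have "\<dots> \<le> t * (A + B) * (1 - 2 * t + t * (A + B))"
    using assms by (simp add: power2_eq_square)
  finally show ?thesis
    using assms by (simp add: pos_divide_le_eq add_pos_pos)
qed

text \<open>\<open>F\<close> dominates each of its three positive summands and ln is increasing, so
  ln F may be replaced by the logarithm of the respective summand.\<close>

lemma mix_entropy_lower:
  fixes A B t :: real
  assumes t: "0 < t" "t < 1 / 2" and A: "A > 0" and B: "B > 0"
  defines "F \<equiv> 1 - 2 * t + t * (A + B)"
  shows "(1 - 2 * t) * ln (1 - 2 * t) + t * ln t * (A + B) + t * (A * ln A + B * ln B) \<le> F * ln F"
proof -
  have pos: "t * A > 0" "t * B > 0" "1 - 2 * t > 0"
    using assms by auto
  then have F: "F \<ge> t * A" "F \<ge> t * B" "F \<ge> 1 - 2 * t" "F > 0"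
    by (auto simp: F_def algebra_simps)
  have "(1 - 2 * t) * ln (1 - 2 * t) \<le> (1 - 2 * t) * ln F"
    "(t * A) * ln (t * A) \<le> (t * A) * ln F" "(t * B) * ln (t * B) \<le> (t * B) * ln F"
    using pos F by (auto intro!: mult_left_mono)
  moreover have "(1 - 2 * t) * ln F + (t * A) * ln F + (t * B) * ln F = F * ln F"
    by (simp add: F_def algebra_simps)
  moreover have "(t * A) * ln (t * A) + (t * B) * ln (t * B)
      = t * ln t * (A + B) + t * (A * ln A + B * ln B)"
    using t A B by (simp add: ln_mult algebra_simps)
  ultimately show ?thesis
    by linarith
qed

text \<open>Convexity of x ln x at 1, A, B with weights 1 - 2 t, t, t, where the value 1 contributes
  nothing. It is read off the tangent bound ln y \<le> y - 1 at y = F / a; the remainders F - a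
  cancel in the weighted sum because \<open>F\<close> is the weighted mean.\<close>

lemma mix_entropy_upper:
  fixes A B t :: real
  assumes t: "0 < t" "t < 1 / 2" and A: "A > 0" and B: "B > 0"
  defines "F \<equiv> 1 - 2 * t + t * (A + B)"
  shows "F * ln F \<le> t * (A * ln A + B * ln B)"
proof -
  have F: "F > 0"
    using assms by (simp add: add_pos_pos)
  have tangent: "a * ln F \<le> a * ln a + F - a" if "a > 0" for a
  proof -
    have "ln (F / a) \<le> F / a - 1"
      using F that by (intro ln_le_minus_one) simp
    then have "a * ln (F / a) \<le> a * (F / a - 1)"
      using that by (intro mult_left_mono) auto
    then show ?thesis
      using F that by (simp add: ln_div right_diff_distrib)
  qed
  have "(1 - 2 * t) * (1 * ln F) \<le> (1 - 2 * t) * (1 * ln 1 + F - 1)"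
    "t * (A * ln F) \<le> t * (A * ln A + F - A)" "t * (B * ln F) \<le> t * (B * ln B + F - B)"
    by (intro mult_left_mono tangent; use assms in simp)+
  moreover have "(1 - 2 * t) * (1 * ln F) + t * (A * ln F) + t * (B * ln F) = F * ln F"
    by (simp add: F_def algebra_simps)
  moreover have "(1 - 2 * t) * (1 * ln 1 + F - 1) + t * (A * ln A + F - A) + t * (B * ln B + F - B)
      = t * (A * ln A + B * ln B)"
    by (simp add: F_def algebra_simps)
  ultimately show ?thesis
    by linarith
qed

lemma mix_entropy:
  assumes t: "0 < t" "t < 1 / 2"
  obtains H where "relative_entropy (mix t v) = ereal H"
    "(1 - 2 * t) * ln (1 - 2 * t) + 2 * t * ln t + t * (norm v)\<^sup>2 \<le> H" "H \<le> t * (norm v)\<^sup>2"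
proof -
  have l: "has_bochner_integral std_gaussian
      (\<lambda>x. (1 - 2 * t) * ln (1 - 2 * t) + t * ln t * (tilt v x + tilt (- v) x)
        + t * (tilt v x * ln (tilt v x) + tilt (- v) x * ln (tilt (- v) x)))
      ((1 - 2 * t) * ln (1 - 2 * t) + t * ln t * (1 + 1) + t * ((norm v)\<^sup>2 / 2 + (norm (- v))\<^sup>2 / 2))"
    by (intro has_bochner_integral_add has_bochner_integral_mult_right has_bochner_integral_tilt
        has_bochner_integral_tilt_ln)
      (simp add: has_bochner_integral_iff gaussian.prob_space[simplified])
  have u: "has_bochner_integral std_gaussian
      (\<lambda>x. t * (tilt v x * ln (tilt v x) + tilt (- v) x * ln (tilt (- v) x)))
      (t * ((norm v)\<^sup>2 / 2 + (norm (- v))\<^sup>2 / 2))"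
    by (intro has_bochner_integral_add has_bochner_integral_mult_right has_bochner_integral_tilt_ln)
  show ?thesis
  proof (rule relative_entropy_bounds[OF integrable.intros[OF l] integrable.intros[OF u]])
    show "(1 - 2 * t) * ln (1 - 2 * t) + t * ln t * (tilt v x + tilt (- v) x)
        + t * (tilt v x * ln (tilt v x) + tilt (- v) x * ln (tilt (- v) x)) \<le> mix t v x * ln (mix t v x)" for x
      unfolding mix_def by (rule mix_entropy_lower[OF t tilt_pos tilt_pos])
    show "mix t v x * ln (mix t v x) \<le> t * (tilt v x * ln (tilt v x) + tilt (- v) x * ln (tilt (- v) x))" for x
      unfolding mix_def by (rule mix_entropy_upper[OF t tilt_pos tilt_pos])
  next
    fix H assume H: "relative_entropy (mix t v) = ereal H"
      "integral\<^sup>L std_gaussian (\<lambda>x. (1 - 2 * t) * ln (1 - 2 * t) + t * ln t * (tilt v x + tilt (- v) x)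
        + t * (tilt v x * ln (tilt v x) + tilt (- v) x * ln (tilt (- v) x))) \<le> H"
      "H \<le> integral\<^sup>L std_gaussian (\<lambda>x. t * (tilt v x * ln (tilt v x) + tilt (- v) x * ln (tilt (- v) x)))"
    show thesis
      using H(2,3) unfolding has_bochner_integral_integral_eq[OF l] has_bochner_integral_integral_eq[OF u]
      by (intro that[OF H(1)]) simp_all
  qed measurable
qed

text \<open>The exponent - 1/8 is a (a - 1) / 2 at a = 1/2. The integral exp (- |v|^2 / 8) is the
  Hellinger affinity of \<gamma> and its translate by v.\<close>

lemma sqrt_tilt: "sqrt (tilt v x) = exp (- (norm v)\<^sup>2 / 8) * tilt ((1 / 2) *\<^sub>R v) x"
  using tilt_powr[of v x "1 / 2"] tilt_pos[of v x] by (simp add: powr_half_sqrt)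

text \<open>The gradient is a scalar multiple of v, so |v|^2 factors out and the scalar estimates
  apply with the two tilts as A and B. The subtracted terms stem from the overlap of the bumps with
  the central component and with each other.\<close>

lemma mix_fisher_information:
  assumes t: "0 < t" "t < 1 / 2"
  obtains I where "fisher_information (mix t v) = ennreal I" "0 \<le> I"
    "(norm v)\<^sup>2 * (2 * t - sqrt t * exp (- (norm v)\<^sup>2 / 8) - 4 * t\<^sup>2 * exp (- (norm v)\<^sup>2) / (1 - 2 * t)) \<le> I"
    "I \<le> 2 * t * (norm v)\<^sup>2"
proof -
  let ?g = "\<lambda>x. (t * (tilt v x - tilt (- v) x)) *\<^sub>R v"
  let ?l = "\<lambda>x. (norm v)\<^sup>2 * (t * (tilt v x + tilt (- v) x) - sqrt t * (sqrt (tilt v x) + sqrt (tilt (- v) x)) / 2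
      - 4 * t\<^sup>2 * exp (- (norm v)\<^sup>2) / (1 - 2 * t))"
  let ?u = "\<lambda>x. (norm v)\<^sup>2 * (t * (tilt v x + tilt (- v) x))"
  have sq: "(norm (?g x))\<^sup>2 / mix t v x
      = (norm v)\<^sup>2 * ((t * (tilt v x - tilt (- v) x))\<^sup>2 / (1 - 2 * t + t * (tilt v x + tilt (- v) x)))" for x
    by (simp add: mix_def power_mult_distrib)
  have s: "has_bochner_integral std_gaussian (\<lambda>x. sqrt (tilt w x)) (exp (- (norm w)\<^sup>2 / 8) * 1)" for w :: "real^'n"
    unfolding sqrt_tilt by (intro has_bochner_integral_mult_right has_bochner_integral_tilt)
  have l: "has_bochner_integral std_gaussian ?l
      ((norm v)\<^sup>2 * (t * (1 + 1) - sqrt t * (exp (- (norm v)\<^sup>2 / 8) * 1 + exp (- (norm (- v))\<^sup>2 / 8) * 1) / 2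
        - 4 * t\<^sup>2 * exp (- (norm v)\<^sup>2) / (1 - 2 * t)))"
    by (intro has_bochner_integral_add has_bochner_integral_diff has_bochner_integral_mult_right
        has_bochner_integral_divide_zero has_bochner_integral_tilt s)
      (simp add: has_bochner_integral_iff gaussian.prob_space[simplified])
  have u: "has_bochner_integral std_gaussian ?u ((norm v)\<^sup>2 * (t * (1 + 1)))"
    by (intro has_bochner_integral_add has_bochner_integral_mult_right has_bochner_integral_tilt)
  obtain I where "fisher_information (mix t v) = ennreal I" "0 \<le> I"
    "(norm v)\<^sup>2 * (t * (1 + 1) - sqrt t * (exp (- (norm v)\<^sup>2 / 8) * 1 + exp (- (norm (- v))\<^sup>2 / 8) * 1) / 2
        - 4 * t\<^sup>2 * exp (- (norm v)\<^sup>2) / (1 - 2 * t)) \<le> I"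
    "I \<le> (norm v)\<^sup>2 * (t * (1 + 1))"
  proof (rule fisher_information_bounds[OF mix_GDERIV _ _ integrable.intros[OF l] integrable.intros[OF u]])
    show "continuous_on UNIV ?g"
      unfolding tilt_def by (intro continuous_intros)
    show "mix t v x > 0" for x
      using t by (simp add: mix_def tilt_pos add_pos_pos)
    show "?l x \<le> (norm (?g x))\<^sup>2 / mix t v x" for x
      unfolding sq using mix_fisher_lower[OF t tilt_pos tilt_pos, of v x "- v" x]
      by (intro mult_left_mono) (simp_all add: tilt_mult_tilt_uminus)
    show "(norm (?g x))\<^sup>2 / mix t v x \<le> ?u x" for x
      unfolding sq by (intro mult_left_mono mix_fisher_upper t tilt_pos) simp
  qed (use that l u in \<open>simp_all only: has_bochner_integral_integral_eq\<close>)
  then show ?thesis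
    by (intro that[of I]) (simp_all add: algebra_simps)
qed

text \<open>The leading terms t |v|^2 cancel between half the information and the entropy. What
  remains are the overlap terms on one side and the Shannon entropy of the weights on the
  other.\<close>

lemma mix_deficit:
  assumes t: "0 < t" "t < 1 / 2"
  obtains d where "deficit (mix t v) = ereal d"
    "- ((norm v)\<^sup>2 * (sqrt t * exp (- (norm v)\<^sup>2 / 8) + 4 * t\<^sup>2 * exp (- (norm v)\<^sup>2) / (1 - 2 * t)) / 2) \<le> d"
    "d \<le> - ((1 - 2 * t) * ln (1 - 2 * t) + 2 * t * ln t)"
proof -
  obtain H where H: "relative_entropy (mix t v) = ereal H"
    "(1 - 2 * t) * ln (1 - 2 * t) + 2 * t * ln t + t * (norm v)\<^sup>2 \<le> H" "H \<le> t * (norm v)\<^sup>2"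
    using mix_entropy[OF t] .
  obtain I where I: "fisher_information (mix t v) = ennreal I" "0 \<le> I"
    "(norm v)\<^sup>2 * (2 * t - sqrt t * exp (- (norm v)\<^sup>2 / 8) - 4 * t\<^sup>2 * exp (- (norm v)\<^sup>2) / (1 - 2 * t)) \<le> I"
    "I \<le> 2 * t * (norm v)\<^sup>2"
    using mix_fisher_information[OF t] .
  have "deficit (mix t v) = ereal (I / 2 - H)"
    using I(2) by (simp add: deficit_def H(1) I(1) enn2ereal_ennreal)
  moreover have "- ((norm v)\<^sup>2 * (sqrt t * exp (- (norm v)\<^sup>2 / 8) + 4 * t\<^sup>2 * exp (- (norm v)\<^sup>2) / (1 - 2 * t)) / 2)
      \<le> I / 2 - H"
  proof -
    have "- ((norm v)\<^sup>2 * (a + b) / 2) \<le> I / 2 - H" if "(norm v)\<^sup>2 * (2 * t - a - b) \<le> I" for a b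
    proof -
      have "(norm v)\<^sup>2 * (2 * t - a - b) = 2 * (t * (norm v)\<^sup>2) - (norm v)\<^sup>2 * (a + b)"
        by (simp add: algebra_simps)
      then show ?thesis
        using that H(3) by linarith
    qed
    from this[OF I(3)] show ?thesis .
  qed
  moreover have "I / 2 - H \<le> - ((1 - 2 * t) * ln (1 - 2 * t) + 2 * t * ln t)"
    using I(4) H(2) by linarith
  ultimately show ?thesis
    using that by blast
qed

lemma mix_pos:
  assumes "0 < t" "t < 1 / 2"
  shows "mix t v x > 0"
  using assms by (simp add: mix_def tilt_pos add_pos_pos)

lemma prob_space_mix:
  assumes "0 < t" "t < 1 / 2"
  shows "prob_space (density std_gaussian (\<lambda>x. ennreal (mix t v x)))"
proof
  have "(\<integral>\<^sup>+x. ennreal (mix t v x) \<partial>std_gaussian) = ennreal (\<integral>x. mix t v x \<partial>std_gaussian)"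
    by (rule nn_integral_eq_integral)
      (use has_bochner_integral_mix[of t v] mix_pos[OF assms, of v] in
        \<open>auto simp: has_bochner_integral_iff less_imp_le\<close>)
  then show "emeasure (density std_gaussian (\<lambda>x. ennreal (mix t v x)))
      (space (density std_gaussian (\<lambda>x. ennreal (mix t v x)))) = 1"
    using has_bochner_integral_integral_eq[OF has_bochner_integral_mix[of t v]]
    by (simp add: emeasure_density)
qed

lemma second_moment_mix:
  fixes v :: "real^'n"
  assumes "0 < t" "t < 1 / 2"
  shows "second_moment (density std_gaussian (\<lambda>x. ennreal (mix t v x)))
    = ennreal (real CARD('n) + 2 * t * (norm v)\<^sup>2)"
proof -
  have "second_moment (density std_gaussian (\<lambda>x. ennreal (mix t v x)))
      = (\<integral>\<^sup>+x. ennreal (mix t v x * (norm x)\<^sup>2) \<partial>std_gaussian)"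
    unfolding second_moment_def using mix_pos[OF assms, of v]
    by (subst nn_integral_density) (auto simp: ennreal_mult less_imp_le)
  also have "\<dots> = ennreal (\<integral>x. mix t v x * (norm x)\<^sup>2 \<partial>std_gaussian)"
    by (rule nn_integral_eq_integral)
      (use has_bochner_integral_mix_norm_square[of t v] mix_pos[OF assms, of v] in
        \<open>auto simp: has_bochner_integral_iff less_imp_le\<close>)
  finally show ?thesis
    using has_bochner_integral_integral_eq[OF has_bochner_integral_mix_norm_square[of t v]] by simp
qed

lemma centered_mix:
  assumes "0 < t" "t < 1 / 2"
  shows "centered (density std_gaussian (\<lambda>x. ennreal (mix t v x)))"
  using has_bochner_integral_mix_id[of t v] mix_pos[OF assms, of v]
  unfolding centered_def has_bochner_integral_iff
  by (subst integrable_density integral_density; auto simp: less_imp_le)+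

section \<open>Wasserstein bounds from second moments\<close>

lemma ennreal_powr_mono: "x \<le> y \<Longrightarrow> 0 \<le> a \<Longrightarrow> ennreal_powr x a \<le> ennreal_powr y a"
  unfolding ennreal_powr_def
  by (auto simp: top_unique powr_mono2 enn2real_mono less_top intro!: ennreal_leI)

text \<open>The independent coupling and |x - y|^2 \<le> 2 |x|^2 + 2 |y|^2. The bound keeps the
  distances in a compact interval, from which a convergent subsequence can be drawn.\<close>

lemma W2_upper:
  fixes \<mu> \<nu> :: "(real^'n) measure"
  assumes \<mu>: "prob_space \<mu>" and \<nu>: "prob_space \<nu>"
    and sets [measurable_cong]: "sets \<mu> = sets borel" "sets \<nu> = sets borel"
    and m2: "second_moment \<mu> = ennreal a" "second_moment \<nu> = ennreal b" and nn: "0 \<le> a" "0 \<le> b"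
  shows "W2 \<mu> \<nu> \<le> ennreal (sqrt (2 * a + 2 * b))"
proof -
  interpret \<mu>: prob_space \<mu> by fact
  interpret \<nu>: prob_space \<nu> by fact
  interpret P: pair_prob_space \<mu> \<nu> ..
  have space: "space \<mu> = UNIV" "space \<nu> = UNIV"
    using sets_eq_imp_space_eq[OF sets(1)] sets_eq_imp_space_eq[OF sets(2)] by auto
  have d1: "distr (\<mu> \<Otimes>\<^sub>M \<nu>) borel fst = \<mu>"
    using \<nu>.distr_pair_fst[of \<mu>] by (simp cong: distr_cong add: sets)
  have d2: "distr (\<mu> \<Otimes>\<^sub>M \<nu>) borel snd = \<nu>"
  proof (rule measure_eqI)
    fix A assume "A \<in> sets (distr (\<mu> \<Otimes>\<^sub>M \<nu>) borel snd)"
    then have [measurable]: "A \<in> sets borel"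
      by simp
    have "emeasure (distr (\<mu> \<Otimes>\<^sub>M \<nu>) borel snd) A = emeasure (\<mu> \<Otimes>\<^sub>M \<nu>) (UNIV \<times> A)"
      by (subst emeasure_distr)
        (auto simp: space_pair_measure space intro!: arg_cong2[where f = emeasure])
    also have "\<dots> = emeasure \<nu> A"
      using \<mu>.emeasure_space_1 by (subst \<nu>.emeasure_pair_measure_Times) (auto simp: sets space)
    finally show "emeasure (distr (\<mu> \<Otimes>\<^sub>M \<nu>) borel snd) A = emeasure \<nu> A" .
  qed (simp add: sets)
  have coup: "\<mu> \<Otimes>\<^sub>M \<nu> \<in> couplings \<mu> \<nu>"
    unfolding couplings_def using P.prob_space_axioms d1 d2 sets
    by (auto intro!: sets_pair_measure_cong)
  have "(\<integral>\<^sup>+z. ennreal ((norm (fst z - snd z))\<^sup>2) \<partial>(\<mu> \<Otimes>\<^sub>M \<nu>))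
      \<le> (\<integral>\<^sup>+z. 2 * ennreal ((norm (fst z))\<^sup>2) + 2 * ennreal ((norm (snd z))\<^sup>2) \<partial>(\<mu> \<Otimes>\<^sub>M \<nu>))"
  proof (rule nn_integral_mono)
    fix z :: "(real^'n) \<times> (real^'n)"
    have "(norm (fst z - snd z))\<^sup>2 \<le> 2 * (norm (fst z))\<^sup>2 + 2 * (norm (snd z))\<^sup>2"
    proof -
      have "0 \<le> (norm (fst z + snd z))\<^sup>2"
        by simp
      then show ?thesis
        by (simp add: power2_norm_eq_inner inner_add_left inner_add_right inner_diff_left
            inner_diff_right inner_commute)
    qed
    then have "ennreal ((norm (fst z - snd z))\<^sup>2) \<le> ennreal (2 * (norm (fst z))\<^sup>2 + 2 * (norm (snd z))\<^sup>2)"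
      by (rule ennreal_leI)
    then show "ennreal ((norm (fst z - snd z))\<^sup>2)
        \<le> 2 * ennreal ((norm (fst z))\<^sup>2) + 2 * ennreal ((norm (snd z))\<^sup>2)"
      by (simp add: ennreal_mult')
  qed
  also have "\<dots> = 2 * (\<integral>\<^sup>+z. ennreal ((norm (fst z))\<^sup>2) \<partial>(\<mu> \<Otimes>\<^sub>M \<nu>))
      + 2 * (\<integral>\<^sup>+z. ennreal ((norm (snd z))\<^sup>2) \<partial>(\<mu> \<Otimes>\<^sub>M \<nu>))"
    by (simp add: nn_integral_add nn_integral_cmult)
  also have "(\<integral>\<^sup>+z. ennreal ((norm (fst z))\<^sup>2) \<partial>(\<mu> \<Otimes>\<^sub>M \<nu>)) = second_moment \<mu>"
    unfolding second_moment_def by (subst (2) d1[symmetric]) (simp add: nn_integral_distr)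
  also have "(\<integral>\<^sup>+z. ennreal ((norm (snd z))\<^sup>2) \<partial>(\<mu> \<Otimes>\<^sub>M \<nu>)) = second_moment \<nu>"
    unfolding second_moment_def by (subst (2) d2[symmetric]) (simp add: nn_integral_distr)
  also have "2 * second_moment \<mu> + 2 * second_moment \<nu> = ennreal (2 * a + 2 * b)"
    unfolding m2 using nn by (simp add: ennreal_mult')
  finally have "ennreal_powr (\<integral>\<^sup>+z. ennreal ((norm (fst z - snd z))\<^sup>2) \<partial>(\<mu> \<Otimes>\<^sub>M \<nu>)) (1 / 2)
      \<le> ennreal_powr (ennreal (2 * a + 2 * b)) (1 / 2)"
    by (rule ennreal_powr_mono) simp
  also have "\<dots> = ennreal (sqrt (2 * a + 2 * b))"
    using nn by (simp add: ennreal_powr_def powr_half_sqrt del: ennreal_plus)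
  finally show ?thesis
    unfolding W2_def using coup by (meson INF_lower2)
qed

text \<open>Uses \<open>|x|\<^sup>2 \<le> (1 + \<epsilon>) |y|\<^sup>2 + (1 + 1/\<epsilon>) |x - y|\<^sup>2\<close>.\<close>

lemma W2_lower:
  fixes \<mu> \<nu> :: "(real^'n) measure"
  assumes m2: "second_moment \<mu> = ennreal a" "second_moment \<nu> = ennreal b" and nn: "0 \<le> b" "0 < \<epsilon>"
    and q: "q * (1 + 1 / \<epsilon>) = a - (1 + \<epsilon>) * b" "0 \<le> q"
  shows "ennreal (sqrt q) \<le> W2 \<mu> \<nu>"
  unfolding W2_def
proof (rule INF_greatest)
  fix \<pi> assume "\<pi> \<in> couplings \<mu> \<nu>"
  then have [measurable_cong]: "sets \<pi> = sets (borel \<Otimes>\<^sub>M borel)" and d: "distr \<pi> borel fst = \<mu>" "distr \<pi> borel snd = \<nu>"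
    by (auto simp: couplings_def)
  let ?I = "\<integral>\<^sup>+z. ennreal ((norm (fst z - snd z))\<^sup>2) \<partial>\<pi>"
  have "ennreal q \<le> ?I"
  proof (cases "?I = \<top>")
    case False
    then obtain w where w: "?I = ennreal w" "0 \<le> w"
      by (cases ?I) auto
    have "ennreal a = (\<integral>\<^sup>+z. ennreal ((norm (fst z))\<^sup>2) \<partial>\<pi>)"
      unfolding m2(1)[symmetric] d(1)[symmetric] second_moment_def by (simp add: nn_integral_distr)
    also have "\<dots> \<le> (\<integral>\<^sup>+z. ennreal (1 + \<epsilon>) * ennreal ((norm (snd z))\<^sup>2)
        + ennreal (1 + 1 / \<epsilon>) * ennreal ((norm (fst z - snd z))\<^sup>2) \<partial>\<pi>)"
    proof (rule nn_integral_mono)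
      fix z :: "(real^'n) \<times> (real^'n)"
      let ?y = "snd z" and ?d = "fst z - snd z"
      \<comment> \<open>Young's inequality 2 y . d \<le> \<epsilon> |y|^2 + |d|^2 / \<epsilon>,
        written as the expansion of a square.\<close>
      have "0 \<le> (norm (sqrt \<epsilon> *\<^sub>R ?y - (1 / sqrt \<epsilon>) *\<^sub>R ?d))\<^sup>2"
        by simp
      also have "\<dots> = \<epsilon> * (norm ?y)\<^sup>2 + 1 / \<epsilon> * (norm ?d)\<^sup>2 - 2 * (?y \<bullet> ?d)"
      proof -
        have "(norm (r *\<^sub>R y - (1 / r) *\<^sub>R d))\<^sup>2 = r\<^sup>2 * (norm y)\<^sup>2 + 1 / r\<^sup>2 * (norm d)\<^sup>2 - 2 * (y \<bullet> d)"
          if "r > 0" for r :: real and y d :: "real^'n"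
          using that by (simp add: power2_norm_eq_inner inner_diff_left inner_diff_right inner_commute
              power2_eq_square[of r])
        from this[of "sqrt \<epsilon>" ?y ?d] show ?thesis
          using nn by simp
      qed
      finally have "2 * (?y \<bullet> ?d) \<le> \<epsilon> * (norm ?y)\<^sup>2 + 1 / \<epsilon> * (norm ?d)\<^sup>2"
        by simp
      moreover have "(norm (fst z))\<^sup>2 = (norm ?y)\<^sup>2 + 2 * (?y \<bullet> ?d) + (norm ?d)\<^sup>2"
        by (simp add: power2_norm_eq_inner inner_diff_left inner_diff_right inner_commute)
      ultimately have "(norm (fst z))\<^sup>2 \<le> (1 + \<epsilon>) * (norm ?y)\<^sup>2 + (1 + 1 / \<epsilon>) * (norm ?d)\<^sup>2"
        by (simp only: distrib_right mult_1_left)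
      then have "ennreal ((norm (fst z))\<^sup>2) \<le> ennreal ((1 + \<epsilon>) * (norm ?y)\<^sup>2 + (1 + 1 / \<epsilon>) * (norm ?d)\<^sup>2)"
        by (rule ennreal_leI)
      also have "\<dots> = ennreal (1 + \<epsilon>) * ennreal ((norm ?y)\<^sup>2) + ennreal (1 + 1 / \<epsilon>) * ennreal ((norm ?d)\<^sup>2)"
        using nn by (subst ennreal_plus) (simp_all add: ennreal_mult del: ennreal_plus)
      finally show "ennreal ((norm (fst z))\<^sup>2)
          \<le> ennreal (1 + \<epsilon>) * ennreal ((norm ?y)\<^sup>2) + ennreal (1 + 1 / \<epsilon>) * ennreal ((norm ?d)\<^sup>2)" .
    qed
    also have "\<dots> = ennreal (1 + \<epsilon>) * (\<integral>\<^sup>+z. ennreal ((norm (snd z))\<^sup>2) \<partial>\<pi>) + ennreal (1 + 1 / \<epsilon>) * ?I"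
      by (simp add: nn_integral_add nn_integral_cmult del: ennreal_plus)
    also have "(\<integral>\<^sup>+z. ennreal ((norm (snd z))\<^sup>2) \<partial>\<pi>) = ennreal b"
      unfolding m2(2)[symmetric] d(2)[symmetric] second_moment_def by (simp add: nn_integral_distr)
    also have "ennreal (1 + \<epsilon>) * ennreal b + ennreal (1 + 1 / \<epsilon>) * ?I = ennreal ((1 + \<epsilon>) * b + (1 + 1 / \<epsilon>) * w)"
      unfolding w using nn w(2) by (subst ennreal_plus) (simp_all add: ennreal_mult del: ennreal_plus)
    finally have "a \<le> (1 + \<epsilon>) * b + (1 + 1 / \<epsilon>) * w"
      using nn w(2) by (subst (asm) ennreal_le_iff) auto
    then have "q * (1 + 1 / \<epsilon>) \<le> w * (1 + 1 / \<epsilon>)"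
      unfolding q by (simp add: algebra_simps)
    then have "q \<le> w"
      using nn by (simp add: add_pos_pos)
    then show ?thesis
      unfolding w by (rule ennreal_leI)
  qed simp
  then have "ennreal_powr (ennreal q) (1 / 2) \<le> ennreal_powr ?I (1 / 2)"
    by (rule ennreal_powr_mono) simp
  then show "ennreal (sqrt q) \<le> ennreal_powr ?I (1 / 2)"
    using q(2) by (simp add: ennreal_powr_def powr_half_sqrt)
qed

text \<open>One bump suffices: t \<open>tilt v\<close> is at most \<open>mix t v\<close>, hence at
  most twice the maximum of 1 and |mix - 1|. In \<open>large\<close> the factor 2^p pays for this
  doubling, and the further factor 2 leaves 2 \<le> 1 + I after integration, so that the p-th moment
  I is at least 1.\<close>

lemma mix_Lp_lower:
  fixes v :: "real^'n"
  assumes t: "0 < t" "t < 1 / 2" and p: "p > 1"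
    and large: "2 powr p * 2 \<le> t powr p * exp (p * (p - 1) * (norm v)\<^sup>2 / 2)"
  shows "1 \<le> Lp_norm p std_gaussian (\<lambda>x. mix t v x - 1)"
proof -
  let ?I = "\<integral>\<^sup>+x. ennreal (\<bar>mix t v x - 1\<bar> powr p) \<partial>std_gaussian"
  have pt: "2 * tilt (p *\<^sub>R v) x \<le> 1 + \<bar>mix t v x - 1\<bar> powr p" for x
  proof -
    let ?y = "\<bar>mix t v x - 1\<bar>"
    have "t * tilt v x \<le> mix t v x"
      using t mult_pos_pos[OF t(1) tilt_pos[of "- v" x]] by (simp add: mix_def distrib_left)
    also have "\<dots> \<le> 1 + ?y"
      by simp
    also have "\<dots> \<le> 2 * max 1 ?y"
      by (auto simp: max_def)
    finally have "(t * tilt v x) powr p \<le> (2 * max 1 ?y) powr p"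
      using t p tilt_pos[of v x] by (intro powr_mono2) auto
    also have "\<dots> = 2 powr p * (max 1 ?y) powr p"
      by (subst powr_mult) auto
    also have "(max 1 ?y) powr p \<le> 1 + ?y powr p"
      by (auto simp: max_def)
    finally have *: "t powr p * tilt v x powr p \<le> 2 powr p * (1 + ?y powr p)"
      using t tilt_pos[of v x] by (simp add: powr_mult less_imp_le)
    have "2 powr p * (2 * tilt (p *\<^sub>R v) x)
        \<le> (t powr p * exp (p * (p - 1) * (norm v)\<^sup>2 / 2)) * tilt (p *\<^sub>R v) x"
      using mult_right_mono[OF large, of "tilt (p *\<^sub>R v) x"] tilt_pos[of "p *\<^sub>R v" x]
      by (simp add: mult_ac)
    also have "\<dots> = t powr p * tilt v x powr p"
      by (simp add: tilt_powr)
    finally have "2 powr p * (2 * tilt (p *\<^sub>R v) x) \<le> 2 powr p * (1 + ?y powr p)"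
      using * by (rule order_trans)
    then show ?thesis
      by (rule mult_left_le_imp_le) simp
  qed
  have "ennreal 2 = (\<integral>\<^sup>+x. ennreal (2 * tilt (p *\<^sub>R v) x) \<partial>std_gaussian)"
  proof -
    have h: "has_bochner_integral std_gaussian (\<lambda>x. 2 * tilt (p *\<^sub>R v) x) (2 * 1)"
      by (intro has_bochner_integral_mult_right has_bochner_integral_tilt)
    then show ?thesis
      using nn_integral_eq_integral[OF integrable.intros[OF h]] has_bochner_integral_integral_eq[OF h]
      by (simp add: tilt_pos less_imp_le)
  qed
  also have "\<dots> \<le> (\<integral>\<^sup>+x. 1 + ennreal (\<bar>mix t v x - 1\<bar> powr p) \<partial>std_gaussian)"
    using pt by (intro nn_integral_mono) (metis ennreal_1 ennreal_leI ennreal_plus powr_ge_zero zero_le_one)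
  also have "\<dots> = 1 + ?I"
    by (subst nn_integral_add) (auto simp: gaussian.emeasure_space_1[simplified])
  finally have "1 + 1 \<le> 1 + ?I"
    by simp
  then have "1 \<le> ?I"
    by (subst (asm) ennreal_add_left_cancel_le) auto
  then have "ennreal_powr 1 (1 / p) \<le> ennreal_powr ?I (1 / p)"
    by (rule ennreal_powr_mono) (use p in simp)
  then show ?thesis
    by (simp add: Lp_norm_def ennreal_powr_def)
qed

section \<open>Choice of parameters and passage to a subsequence\<close>

theorem theorem1p1:
  fixes M p :: real
  assumes "M > real CARD('n::finite)" and "p > 1"
  shows "\<exists>(f :: nat \<Rightarrow> real^'n \<Rightarrow> real) (\<mu> :: nat \<Rightarrow> (real^'n) measure) (c :: real).
    (\<forall>k. (\<forall>x. f k x \<ge> 0) \<and> integrable std_gaussian (f k) \<and>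
         \<mu> k = density std_gaussian (\<lambda>x. ennreal (f k x)) \<and>
         \<mu> k \<in> P2 M \<and> centered (\<mu> k)) \<and>
    (\<lambda>k. deficit (f k)) \<longlonglongrightarrow> 0 \<and>
    c > 0 \<and> (\<lambda>k. W2 (\<mu> k) std_gaussian) \<longlonglongrightarrow> ennreal c \<and>
    liminf (\<lambda>k. Lp_norm p std_gaussian (\<lambda>x. f k x - 1)) > 0"
proof -
  let ?n = "real CARD('n)"
  define s where "s = M - ?n"
  have s: "s > 0"
    using assms by (simp add: s_def)
  \<comment> \<open>The offset 3 keeps 2 t below 1 already at k = 0, and |v|^2 = s (k + 3) / 2 makes
    2 t |v|^2 = s, so the second moment is exactly M for every k. The direction of v is an arbitrary
    coordinate axis.\<close>
  define t where "t k = 1 / (real k + 3)" for k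
  define v :: "nat \<Rightarrow> real^'n" where "v k = sqrt (s * (real k + 3) / 2) *\<^sub>R axis undefined 1" for k
  define F where "F k = mix (t k) (v k)" for k
  define \<nu> where "\<nu> k = density std_gaussian (\<lambda>x. ennreal (F k x))" for k
  have t: "0 < t k" "t k < 1 / 2" for k
    by (auto simp: t_def field_simps)
  have nv: "(norm (v k))\<^sup>2 = s * (real k + 3) / 2" for k
    using s by (simp add: v_def norm_axis_1)
  have m2: "second_moment (\<nu> k) = ennreal M" for k
  proof -
    have "real k + 3 \<noteq> 0"
      by simp
    then have "2 * t k * (norm (v k))\<^sup>2 = s"
      unfolding nv t_def by (simp del: of_nat_eq_0_iff)
    then show ?thesis
      unfolding \<nu>_def F_def second_moment_mix[OF t] by (simp add: s_def)
  qed
  have prob: "prob_space (\<nu> k)" and cent: "centered (\<nu> k)" for k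
    unfolding \<nu>_def F_def by (rule prob_space_mix[OF t] centered_mix[OF t])+
  have sets: "sets (\<nu> k) = sets borel" for k
    by (simp add: \<nu>_def)
  have int: "integrable std_gaussian (F k)" for k
    unfolding F_def by (rule integrable.intros[OF has_bochner_integral_mix])

  have "\<exists>d. deficit (F k) = ereal d
      \<and> - ((norm (v k))\<^sup>2 * (sqrt (t k) * exp (- (norm (v k))\<^sup>2 / 8)
            + 4 * (t k)\<^sup>2 * exp (- (norm (v k))\<^sup>2) / (1 - 2 * t k)) / 2) \<le> d
      \<and> d \<le> - ((1 - 2 * t k) * ln (1 - 2 * t k) + 2 * t k * ln (t k))" for k
    unfolding F_def by (rule mix_deficit[OF t, of k "v k"]) blast
  then obtain d where d: "deficit (F k) = ereal (d k)"
      "- ((norm (v k))\<^sup>2 * (sqrt (t k) * exp (- (norm (v k))\<^sup>2 / 8)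
            + 4 * (t k)\<^sup>2 * exp (- (norm (v k))\<^sup>2) / (1 - 2 * t k)) / 2) \<le> d k"
      "d k \<le> - ((1 - 2 * t k) * ln (1 - 2 * t k) + 2 * t k * ln (t k))" for k
    by metis
  \<comment> \<open>In the lower bound the linear growth of |v|^2 in k meets exponential decay in k;
    the upper bound is the Shannon entropy of weights that concentrate on the central
    component.\<close>
  have "d \<longlonglongrightarrow> 0"
  proof (rule real_tendsto_sandwich)
    show "\<forall>\<^sub>F k in sequentially. - ((norm (v k))\<^sup>2 * (sqrt (t k) * exp (- (norm (v k))\<^sup>2 / 8)
            + 4 * (t k)\<^sup>2 * exp (- (norm (v k))\<^sup>2) / (1 - 2 * t k)) / 2) \<le> d k"
      using d(2) by simp
    show "\<forall>\<^sub>F k in sequentially. d k \<le> - ((1 - 2 * t k) * ln (1 - 2 * t k) + 2 * t k * ln (t k))"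
      using d(3) by simp
    show "(\<lambda>k. - ((norm (v k))\<^sup>2 * (sqrt (t k) * exp (- (norm (v k))\<^sup>2 / 8)
            + 4 * (t k)\<^sup>2 * exp (- (norm (v k))\<^sup>2) / (1 - 2 * t k)) / 2)) \<longlonglongrightarrow> 0"
      unfolding nv t_def using s by real_asymp
    show "(\<lambda>k. - ((1 - 2 * t k) * ln (1 - 2 * t k) + 2 * t k * ln (t k))) \<longlonglongrightarrow> 0"
      unfolding t_def by real_asymp
  qed
  then have def: "(\<lambda>k. deficit (F k)) \<longlonglongrightarrow> 0"
    unfolding d(1) zero_ereal_def by (rule tendsto_ereal)

  have "filterlim (\<lambda>k. t k powr p * exp (p * (p - 1) * (norm (v k))\<^sup>2 / 2)) at_top sequentially"
    unfolding nv t_def using s assms(2) by real_asymp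
  then have "\<forall>\<^sub>F k in sequentially. 2 powr p * 2 \<le> t k powr p * exp (p * (p - 1) * (norm (v k))\<^sup>2 / 2)"
    by (simp add: filterlim_at_top)
  then have Lp: "\<forall>\<^sub>F k in sequentially. 1 \<le> Lp_norm p std_gaussian (\<lambda>x. F k x - 1)"
    unfolding F_def by (rule eventually_mono) (rule mix_Lp_lower[OF t assms(2)])

  \<comment> \<open>Half of the moment excess s pays for the factor 1 + \<epsilon>: with \<epsilon>
    n = s / 2 one has M - (1 + \<epsilon>) n = s / 2, and \<open>q\<close> is this remainder divided
    by 1 + 1 / \<epsilon>.\<close>
  define \<epsilon> where "\<epsilon> = s / (2 * ?n)"
  have \<epsilon>: "\<epsilon> > 0"
    using s by (simp add: \<epsilon>_def)
  define q where "q = s / 2 / (1 + 1 / \<epsilon>)"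
  have q: "q > 0"
    using s \<epsilon> by (simp add: q_def add_pos_pos)
  define C where "C = sqrt (2 * M + 2 * ?n)"
  have W: "ennreal (sqrt q) \<le> W2 (\<nu> k) std_gaussian" "W2 (\<nu> k) std_gaussian \<le> ennreal C" for k
  proof -
    have "1 + 1 / \<epsilon> > 0"
      using \<epsilon> by (simp add: add_pos_pos)
    then have "q * (1 + 1 / \<epsilon>) = s / 2"
      unfolding q_def by (metis less_irrefl nonzero_eq_divide_eq)
    moreover have "\<epsilon> * ?n = s / 2"
      by (simp add: \<epsilon>_def)
    ultimately have "q * (1 + 1 / \<epsilon>) = M - (1 + \<epsilon>) * ?n"
      by (simp add: distrib_right s_def)
    from W2_lower[OF m2 second_moment_std_gaussian _ \<epsilon> this]
    show "ennreal (sqrt q) \<le> W2 (\<nu> k) std_gaussian"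
      using q by simp
    show "W2 (\<nu> k) std_gaussian \<le> ennreal C"
      unfolding C_def using assms(1)
      by (intro W2_upper[OF prob prob_space_std_gaussian _ _ m2 second_moment_std_gaussian]) (auto simp: sets)
  qed
  define w where "w k = enn2real (W2 (\<nu> k) std_gaussian)" for k
  have w: "W2 (\<nu> k) std_gaussian = ennreal (w k)" for k
    using W(2)[of k] by (simp add: w_def less_top ennreal_less_top le_less_trans)
  have "w k \<in> {sqrt q..C}" for k
    using W[of k] assms(1) enn2real_nonneg unfolding w
    by (auto simp: w_def C_def ennreal_le_iff)
  \<comment> \<open>Bolzano-Weierstrass: \<open>c\<close> is a limit point of the distances,
    positive because all of them are at least sqrt q. The deficit limit and the eventual L^p bound
    pass to the subsequence.\<close>
  then obtain c r where r: "strict_mono (r :: nat \<Rightarrow> nat)" "c \<in> {sqrt q..C}" "(w \<circ> r) \<longlonglongrightarrow> c"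
    using compact_Icc[of "sqrt q" C] unfolding compact_def by blast
  have c: "c > 0"
    using r(2) q by (auto intro: less_le_trans[of 0 "sqrt q"])
  have sub: "filterlim r sequentially sequentially"
    using r(1) by (rule filterlim_subseq)

  show ?thesis
  proof (intro exI conjI allI)
    show "0 \<le> F (r k) x" for k x
      unfolding F_def by (rule less_imp_le[OF mix_pos[OF t]])
    show "integrable std_gaussian (F (r k))" for k
      by (rule int)
    show "\<nu> (r k) = density std_gaussian (\<lambda>x. ennreal (F (r k) x))" for k
      by (simp add: \<nu>_def)
    show "\<nu> (r k) \<in> P2 M" for k
      unfolding P2_def using sets prob m2 by simp
    show "centered (\<nu> (r k))" for k
      by (rule cent)
    show "(\<lambda>k. deficit (F (r k))) \<longlonglongrightarrow> 0"
      using def sub by (rule filterlim_compose)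
    show "c > 0"
      by (rule c)
    show "(\<lambda>k. W2 (\<nu> (r k)) std_gaussian) \<longlonglongrightarrow> ennreal c"
      unfolding w using r(3) by (intro tendsto_ennrealI) (simp add: o_def)
    have "\<forall>\<^sub>F k in sequentially. 1 \<le> Lp_norm p std_gaussian (\<lambda>x. F (r k) x - 1)"
      using Lp sub by (rule eventually_compose_filterlim)
    then have "1 \<le> liminf (\<lambda>k. Lp_norm p std_gaussian (\<lambda>x. F (r k) x - 1))"
      by (rule Liminf_bounded)
    then show "0 < liminf (\<lambda>k. Lp_norm p std_gaussian (\<lambda>x. F (r k) x - 1))"
      by (rule less_le_trans[OF zero_less_one])
  qed
qed

end
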